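(* There is a constant $c>0$, independent of $m,n,k,\delta,\mu$, such that the following holds for all positive integers $k,m,n$ with $m\le n$, every $\delta\in(0,1)$ and every precision $\mu>0$. Let $\mathbf B$ be a random $n\times k$ matrix with i.i.d. $\mathsf N(0,1)$ entries. Then $\mathbf B$ satisfies the R-RIP over $\mathcal H-\mathcal H$ with parameter $\delta$ and precision $\mu$ with probability larger than $$1-2\Big(1+\frac{2}{\delta}\Big)^{2k}\binom{n}{m}^2e^{-cm\delta^2\mu^2}.$$
   Context: $\mathcal S$ is the set of ordered selection matrices: $m\times n$ matrices $\mathbf S$ with entries in $\{0,1\}$ for which there are indices $1\le i_1<\dots<i_m\le n$ with $\mathbf S_{l,p}=1$ if $p=i_l$ and $\mathbf S_{l,p}=0$ otherwise. $\mathcal H=\{\mathbf y^{T}\otimes\mathbf S:\mathbf y\in\mathbb R^k,\mathbf S\in\mathcal S\}$ (Kronecker product). With $\mathbb b=\mathrm{vec}(\mathbf B)$ (columns stacked), $(\mathbf y^T\otimes\mathbf S)\mathbb b=\mathbf S\mathbf B\mathbf y$. $\mathbf B$ satisfies the R-RIP (relaxed restricted isometry property) over $\mathcal H-\mathcal H$ with parameter $\delta$ and precision $\mu$ if $(1-\delta)\|\mathbf H-\mathbf H'\|_F^2\le\|(\mathbf H-\mathbf H')\mathbb b\|^2\le(1+\delta)\|\mathbf H-\mathbf H'\|_F^2$ holds for all $\mathbf H,\mathbf H'\in\mathcal H$ with $\|\mathbf H-\mathbf H'\|_F\ge\mu\max\{\|\mathbf H\|_F,\|\mathbf H'\|_F\}$.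 Here $\|\cdot\|$ is the Euclidean norm and $\|\cdot\|_F$ the Frobenius norm. *)

theory Defs
  imports "HOL-Probability.Probability" "Jordan_Normal_Form.Matrix"
begin

unbundle no vec_syntax
unbundle no inner_syntax

text \<open>All matrices are 0-based, so \<^term>\<open>i\<close> below enumerates the selected columns
  \<open>i 0 < \<dots> < i (m - 1)\<close> in \<open>{0..<n}\<close>.\<close>

definition selection_matrices :: "nat \<Rightarrow> nat \<Rightarrow> real mat set" where
  "selection_matrices m n =
    {S \<in> carrier_mat m n. \<exists>i :: nat \<Rightarrow> nat.
       (\<forall>l<m. i l < n) \<and> strict_mono_on {..<m} i \<and>
       (\<forall>l<m. \<forall>p<n. S $$ (l, p) = (if p = i l then 1 else 0))}"

definition kronecker :: "'a :: semiring_0 mat \<Rightarrow> 'a mat \<Rightarrow> 'a mat" where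
  "kronecker A B = mat (dim_row A * dim_row B) (dim_col A * dim_col B)
     (\<lambda>(r, c). A $$ (r div dim_row B, c div dim_col B) * B $$ (r mod dim_row B, c mod dim_col B))"

definition vec_of_mat :: "'a mat \<Rightarrow> 'a vec" where
  "vec_of_mat B = vec (dim_row B * dim_col B) (\<lambda>r. B $$ (r mod dim_row B, r div dim_row B))"

definition vnorm :: "real vec \<Rightarrow> real" where
  "vnorm v = L2_set (\<lambda>i. v $ i) {..<dim_vec v}"

definition frob_norm :: "real mat \<Rightarrow> real" where
  "frob_norm A = L2_set (\<lambda>p. A $$ p) ({..<dim_row A} \<times> {..<dim_col A})"

definition H_set :: "nat \<Rightarrow> nat \<Rightarrow> nat \<Rightarrow> real mat set" where
  "H_set k m n = {kronecker (mat_of_row y) S | y S. y \<in> carrier_vec k \<and> S \<in> selection_matrices m n}"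

definition R_RIP :: "real mat set \<Rightarrow> real \<Rightarrow> real \<Rightarrow> real mat \<Rightarrow> bool" where
  "R_RIP HH \<delta> \<mu> B \<longleftrightarrow>
    (\<forall>H\<in>HH. \<forall>H'\<in>HH.
       frob_norm (H - H') \<ge> \<mu> * max (frob_norm H) (frob_norm H') \<longrightarrow>
       (1 - \<delta>) * (frob_norm (H - H'))\<^sup>2 \<le> (vnorm ((H - H') *\<^sub>v vec_of_mat B))\<^sup>2 \<and>
       (vnorm ((H - H') *\<^sub>v vec_of_mat B))\<^sup>2 \<le> (1 + \<delta>) * (frob_norm (H - H'))\<^sup>2)"

text \<open>The joint law of the entries of an \<open>n \<times> k\<close> matrix with i.i.d. standard normal entries; a
  sample \<open>\<omega>\<close> gives the matrix \<open>mat n k \<omega>\<close>. The lemma \<open>iid_std_normal_entries_law\<close> shows that the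
  entries of any such random matrix, on any probability space, have this law.\<close>

definition gaussian_entries :: "nat \<Rightarrow> nat \<Rightarrow> (nat \<times> nat \<Rightarrow> real) measure" where
  "gaussian_entries n k = (\<Pi>\<^sub>M p\<in>{..<n} \<times> {..<k}. std_normal_distribution)"

lemma (in prob_space) iid_std_normal_entries_law:
  fixes X :: "nat \<times> nat \<Rightarrow> 'a \<Rightarrow> real"
  assumes "0 < n" "0 < k"
    and indep: "indep_vars (\<lambda>_. borel) X ({..<n} \<times> {..<k})"
    and normal: "\<And>p. p \<in> {..<n} \<times> {..<k} \<Longrightarrow> distributed M lborel (X p) std_normal_density"
  shows "distr M (\<Pi>\<^sub>M p\<in>{..<n} \<times> {..<k}. borel) (\<lambda>\<omega>. \<lambda>p\<in>{..<n} \<times> {..<k}. X p \<omega>) =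
    gaussian_entries n k"
proof -
  let ?I = "{..<n} \<times> {..<k}"
  have ne: "?I \<noteq> {}" using assms(1,2) by auto
  have rv: "\<And>p. p \<in> ?I \<Longrightarrow> random_variable borel (X p)"
    using indep unfolding indep_vars_def by auto
  have d: "distr M borel (X p) = std_normal_distribution" if "p \<in> ?I" for p
  proof -
    have "distr M borel (X p) = distr M lborel (X p)" by (rule distr_cong) auto
    also have "\<dots> = std_normal_distribution"
      using normal[OF that] by (simp add: distributed_def)
    finally show ?thesis .
  qed
  have "distr M (\<Pi>\<^sub>M p\<in>?I. borel) (\<lambda>\<omega>. \<lambda>p\<in>?I. X p \<omega>) = (\<Pi>\<^sub>M p\<in>?I. distr M borel (X p))"
    using indep_vars_iff_distr_eq_PiM'[where M' = "\<lambda>_. borel" and X = X, OF ne] rv indep by auto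
  also have "\<dots> = gaussian_entries n k"
    unfolding gaussian_entries_def by (intro PiM_cong refl d)
  finally show ?thesis .
qed

end

theory Submission
  imports Defs
begin

text \<open>Put \<open>x = c m \<delta>\<^sup>2 \<mu>\<^sup>2\<close>. If the claimed lower bound is negative there is nothing to show; otherwise \<open>exp x\<close>
  is at least \<open>2 * 9 ^ k * (n choose m)\<^sup>2\<close>, so that failure probabilities \<open>O(1024 ^ (2 * k)) * exp (- 8 * x)\<close> per
  pair of selections are affordable.

  For \<open>H = y\<^sup>T \<otimes> S\<close> and \<open>H' = y'\<^sup>T \<otimes> S'\<close>, let \<open>q\<close> be the number of rows in which \<open>S\<close> and \<open>S'\<close> agree and \<open>p = m - q\<close>.
  Then \<open>f = \<parallel>H - H'\<parallel>\<^sup>2 = q \<parallel>y - y'\<parallel>\<^sup>2 + p (\<parallel>y\<parallel>\<^sup>2 + \<parallel>y'\<parallel>\<^sup>2)\<close>, and the image of \<open>vec B\<close> splits accordingly into a few blocks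
  \<open>G w\<close>, where \<open>G\<close> has distinct, hence independent, entries of \<open>B\<close> and \<open>w\<close> is \<open>y - y'\<close> or \<open>(y, - y')\<close>. A chi-square
  Chernoff bound on a finite net of the unit ball gives, for all \<open>w\<close> at once,
  \<open>\<bar>\<parallel>G w\<parallel>\<^sup>2 - N \<parallel>w\<parallel>\<^sup>2\<bar> \<le> 96 (sqrt (N x) + x) \<parallel>w\<parallel>\<^sup>2\<close> for \<open>N\<close> rows. The precision condition yields
  \<open>m \<mu>\<^sup>2 (\<parallel>y\<parallel>\<^sup>2 + \<parallel>y'\<parallel>\<^sup>2) \<le> 2 f\<close>, i.e. \<open>x \<parallel>w\<parallel>\<^sup>2\<close> is at most a small multiple of \<open>\<delta>\<^sup>2 f\<close>, while \<open>N \<parallel>w\<parallel>\<^sup>2\<close> is at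
  most \<open>f\<close>; so the deviations add up to at most \<open>\<delta> f\<close>. No net adapted to the precision condition is needed.\<close>

section \<open>Chi-square concentration\<close>

text \<open>Completing the square: the weight turns the standard normal density into
  \<open>\<sigma>\<close> times the centred normal density of variance
  \<open>1 / (1 - 2 * s)\<close>, which has mass 1.\<close>

lemma nn_integral_exp_sq_std_normal:
  fixes s :: real
  assumes "s < 1/2"
  shows "(\<integral>\<^sup>+ z. ennreal (exp (s * z\<^sup>2)) \<partial>std_normal_distribution) = ennreal (1 / sqrt (1 - 2 * s))"
proof -
  define \<sigma> where "\<sigma> = 1 / sqrt (1 - 2 * s)"
  have \<sigma>: "\<sigma> > 0" and \<sigma>2: "1 / \<sigma>\<^sup>2 = 1 - 2 * s"
    using assms by (simp_all add: \<sigma>_def power_divide)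
  have dens: "std_normal_density z * exp (s * z\<^sup>2) = \<sigma> * normal_density 0 \<sigma> z" for z
  proof -
    have e: "- (z\<^sup>2 / (2 * \<sigma>\<^sup>2)) = - z\<^sup>2 / 2 + s * z\<^sup>2"
    proof -
      have "z\<^sup>2 / (2 * \<sigma>\<^sup>2) = z\<^sup>2 / 2 * (1 / \<sigma>\<^sup>2)" by simp
      then show ?thesis unfolding \<sigma>2 by (simp add: algebra_simps)
    qed
    have r: "sqrt (2 * pi * \<sigma>\<^sup>2) = sqrt (2 * pi) * \<sigma>"
      using \<sigma> by (simp add: real_sqrt_mult)
    have "exp (- z\<^sup>2 / 2) * exp (s * z\<^sup>2) = exp (- (z - 0)\<^sup>2 / (2 * \<sigma>\<^sup>2))"
      using e by (simp add: exp_add[symmetric])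
    then show ?thesis
      unfolding std_normal_density_def normal_density_def r using \<sigma> by simp
  qed
  have "(\<integral>\<^sup>+ z. ennreal (exp (s * z\<^sup>2)) \<partial>std_normal_distribution) =
      (\<integral>\<^sup>+ z. ennreal (std_normal_density z) * ennreal (exp (s * z\<^sup>2)) \<partial>lborel)"
    by (subst nn_integral_density) auto
  also have "\<dots> = (\<integral>\<^sup>+ z. ennreal \<sigma> * ennreal (normal_density 0 \<sigma> z) \<partial>lborel)"
    using \<sigma> by (intro nn_integral_cong) (simp add: ennreal_mult[symmetric] dens)
  also have "\<dots> = ennreal \<sigma> * (\<integral>\<^sup>+ z. ennreal (normal_density 0 \<sigma> z) \<partial>lborel)"
    by (rule nn_integral_cmult) auto
  also have "(\<integral>\<^sup>+ z. ennreal (normal_density 0 \<sigma> z) \<partial>lborel) = 1"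
    using \<sigma> by (subst nn_integral_eq_integral) auto
  finally show ?thesis by (simp add: \<sigma>_def)
qed

text \<open>The logarithm of the moment is \<open>- ln (1 - 2 * s) / 2 - s\<close>. Centring cancels
  its linear term, and the second-order bound on \<open>ln (1 + u) - u\<close> at
  \<open>u = - 2 * s\<close> leaves a quadratic, as for a sub-Gaussian variable.\<close>

lemma nn_integral_exp_centered_sq_le:
  fixes s :: real
  assumes "\<bar>s\<bar> \<le> 1/4"
  shows "(\<integral>\<^sup>+ z. ennreal (exp (s * (z\<^sup>2 - 1))) \<partial>std_normal_distribution) \<le> ennreal (exp (4 * s\<^sup>2))"
proof -
  have pos: "1 - 2 * s > 0" using assms by auto
  have "\<bar>ln (1 + (- 2 * s)) - (- 2 * s)\<bar> \<le> 2 * (- 2 * s)\<^sup>2"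
    using assms by (intro abs_ln_one_plus_x_minus_x_bound) auto
  then have ln: "- ln (1 - 2 * s) / 2 - s \<le> 4 * s\<^sup>2" by (auto simp: abs_le_iff)
  have "(\<integral>\<^sup>+ z. ennreal (exp (s * (z\<^sup>2 - 1))) \<partial>std_normal_distribution) =
      (\<integral>\<^sup>+ z. ennreal (exp (- s)) * ennreal (exp (s * z\<^sup>2)) \<partial>std_normal_distribution)"
    by (intro nn_integral_cong) (simp add: ennreal_mult[symmetric] exp_add[symmetric] algebra_simps)
  also have "\<dots> = ennreal (exp (- s)) * ennreal (1 / sqrt (1 - 2 * s))"
    using assms by (subst nn_integral_cmult) (auto simp: nn_integral_exp_sq_std_normal)
  also have "\<dots> = ennreal (exp (- ln (1 - 2 * s) / 2 - s))"
  proof -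
    have "exp (ln (1 - 2 * s) / 2) = exp (ln (sqrt (1 - 2 * s)))"
      using pos by (simp add: ln_sqrt)
    then have "sqrt (1 - 2 * s) = exp (ln (1 - 2 * s) / 2)" using pos by simp
    then show ?thesis
      by (simp add: ennreal_mult[symmetric] exp_add[symmetric] exp_minus inverse_eq_divide[symmetric]
          flip: exp_minus)
  qed
  also have "\<dots> \<le> ennreal (exp (4 * s\<^sup>2))" using ln by (intro ennreal_leI) simp
  finally show ?thesis .
qed

lemma (in prob_space) chi_square_exp_moment_le:
  fixes Z :: "'i \<Rightarrow> 'a \<Rightarrow> real" and s :: real
  assumes L: "finite L" and ind: "indep_vars (\<lambda>_. borel) Z L"
    and nrm: "\<And>l. l \<in> L \<Longrightarrow> distributed M lborel (Z l) std_normal_density"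
    and s: "\<bar>s\<bar> \<le> 1/4"
  shows "(\<integral>\<^sup>+ \<omega>. ennreal (exp (s * ((\<Sum>l\<in>L. (Z l \<omega>)\<^sup>2) - card L))) \<partial>M) \<le> ennreal (exp (4 * card L * s\<^sup>2))"
proof -
  have "(\<integral>\<^sup>+ \<omega>. ennreal (exp (s * ((\<Sum>l\<in>L. (Z l \<omega>)\<^sup>2) - card L))) \<partial>M) =
      (\<integral>\<^sup>+ \<omega>. (\<Prod>l\<in>L. ennreal (exp (s * ((Z l \<omega>)\<^sup>2 - 1)))) \<partial>M)"
    using L by (intro nn_integral_cong)
      (simp add: prod_ennreal exp_sum[symmetric] sum_distrib_left[symmetric] sum_subtractf)
  also have "\<dots> = (\<Prod>l\<in>L. \<integral>\<^sup>+ \<omega>. ennreal (exp (s * ((Z l \<omega>)\<^sup>2 - 1))) \<partial>M)"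
    by (intro indep_vars_nn_integral L indep_vars_compose2[OF ind]) auto
  also have "\<dots> \<le> (\<Prod>l\<in>L. ennreal (exp (4 * s\<^sup>2)))"
  proof (intro prod_mono_ennreal)
    fix l assume l: "l \<in> L"
    have "(\<integral>\<^sup>+ \<omega>. ennreal (exp (s * ((Z l \<omega>)\<^sup>2 - 1))) \<partial>M) =
       (\<integral>\<^sup>+ z. ennreal (exp (s * (z\<^sup>2 - 1))) \<partial>distr M lborel (Z l))"
      using distributed_measurable[OF nrm[OF l]] by (subst nn_integral_distr) auto
    also have "distr M lborel (Z l) = std_normal_distribution"
      using nrm[OF l] by (simp add: distributed_def)
    also have "(\<integral>\<^sup>+ z. ennreal (exp (s * (z\<^sup>2 - 1))) \<partial>std_normal_distribution) \<le> ennreal (exp (4 * s\<^sup>2))"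
      by (rule nn_integral_exp_centered_sq_le[OF s])
    finally show "(\<integral>\<^sup>+ \<omega>. ennreal (exp (s * ((Z l \<omega>)\<^sup>2 - 1))) \<partial>M) \<le> ennreal (exp (4 * s\<^sup>2))" .
  qed
  also have "\<dots> = ennreal (exp (4 * card L * s\<^sup>2))"
    by (simp add: prod_ennreal exp_of_nat_mult[symmetric] ennreal_power mult_ac)
  finally show ?thesis .
qed

text \<open>Chernoff bound: the moment estimate gives the exponent
  \<open>4 * N * s ^ 2 - s * t\<close>. The summands of the threshold \<open>t\<close> reflect the
  two regimes of a chi-square tail, Gaussian while \<open>x\<close> is small against
  \<open>N\<close> and exponential beyond. The rate 8 is what the final union bound
  consumes.\<close>

lemma (in prob_space) chi_square_tail:
  fixes Z :: "'i \<Rightarrow> 'a \<Rightarrow> real" and x :: real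
  assumes L: "finite L" and ind: "indep_vars (\<lambda>_. borel) Z L"
    and nrm: "\<And>l. l \<in> L \<Longrightarrow> distributed M lborel (Z l) std_normal_density"
    and x: "0 \<le> x"
  shows "prob {\<omega> \<in> space M. \<bar>(\<Sum>l\<in>L. (Z l \<omega>)\<^sup>2) - card L\<bar> \<ge> 48 * (sqrt (card L * x) + x)}
    \<le> 2 * exp (- 8 * x)"
proof -
  define N where "N = real (card L)"
  define t where "t = 48 * (sqrt (N * x) + x)"
  define W where "W = (\<lambda>\<omega>. (\<Sum>l\<in>L. (Z l \<omega>)\<^sup>2) - N)"
  have N: "N \<ge> 0" by (simp add: N_def)
  have [measurable]: "random_variable borel (Z l)" if "l \<in> L" for l
    using ind that by (auto simp: indep_vars_def)
  have [measurable]: "W \<in> borel_measurable M" unfolding W_def by measurable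
  obtain s where s: "0 \<le> s" "s \<le> 1/4" and st: "4 * N * s\<^sup>2 - s * t \<le> - 8 * x"
  proof (cases "16 * x \<ge> N")
    \<comment> \<open>The largest admissible \<open>s\<close> is taken: \<open>N / 4\<close> is at
      most \<open>4 * x\<close>, and with the term \<open>- 12 * x\<close> this leaves
      \<open>- 8 * x\<close>.\<close>
    case True
    have "sqrt (N * x) \<ge> 0" using N x by simp
    moreover have "4 * N * (1/4)\<^sup>2 - (1/4) * t = N / 4 - 12 * sqrt (N * x) - 12 * x"
      by (simp add: t_def power2_eq_square algebra_simps)
    ultimately have "4 * N * (1/4)\<^sup>2 - (1/4) * t \<le> - 8 * x"
      using True by linarith
    then show ?thesis using that[of "1/4"] by auto
  next
    case False
    then have N0: "N > 0" using x by simp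
    \<comment> \<open>Here \<open>16 * x < N\<close> keeps \<open>?s\<close> below 1/4. As
      \<open>?s * sqrt (N * x) = x\<close>, the quadratic term costs \<open>4 * x\<close> while the
      linear one gains at least \<open>48 * x\<close>.\<close>
    let ?s = "sqrt (x / N)"
    have s0: "?s \<ge> 0" using N0 x by simp
    have "?s \<le> sqrt ((1/4)\<^sup>2)"
      using False N0 by (intro real_sqrt_le_mono) (simp add: power2_eq_square field_simps)
    then have s1: "?s \<le> 1/4" by simp
    have "?s * sqrt (N * x) = x"
      using N0 x by (simp add: real_sqrt_mult real_sqrt_divide)
    moreover have "4 * N * ?s\<^sup>2 = 4 * x" using N0 x by simp
    moreover have "?s * t = 48 * (?s * sqrt (N * x)) + 48 * (?s * x)" by (simp add: t_def algebra_simps)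
    moreover have "?s * x \<ge> 0" using s0 x by simp
    ultimately have "4 * N * ?s\<^sup>2 - ?s * t \<le> - 8 * x" using x by linarith
    then show ?thesis using that[of ?s] s0 s1 by blast
  qed
  \<comment> \<open>The sign \<open>\<sigma>\<close> treats both tails at once; the moment bound
    sees only the square of \<open>s * \<sigma>\<close>.\<close>
  have tail: "prob {\<omega> \<in> space M. \<sigma> * W \<omega> \<ge> t} \<le> exp (- 8 * x)" if \<sigma>: "\<bar>\<sigma>\<bar> = 1" for \<sigma> :: real
  proof -
    have sub: "{\<omega> \<in> space M. \<sigma> * W \<omega> \<ge> t} \<subseteq> {\<omega> \<in> space M. 1 \<le> ennreal (exp (- s * t)) * ennreal (exp (s * \<sigma> * W \<omega>))}"
    proof safe
      fix \<omega> assume "t \<le> \<sigma> * W \<omega>"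
      then have "0 \<le> - s * t + s * \<sigma> * W \<omega>" using s mult_left_mono[of t "\<sigma> * W \<omega>" s] by simp
      then have "1 \<le> exp (- s * t) * exp (s * \<sigma> * W \<omega>)" unfolding exp_add[symmetric] by simp
      then show "1 \<le> ennreal (exp (- s * t)) * ennreal (exp (s * \<sigma> * W \<omega>))"
        by (simp add: ennreal_mult[symmetric])
    qed
    have "emeasure M {\<omega> \<in> space M. \<sigma> * W \<omega> \<ge> t} \<le>
        emeasure M {\<omega> \<in> space M. 1 \<le> ennreal (exp (- s * t)) * ennreal (exp (s * \<sigma> * W \<omega>))}"
      by (intro emeasure_mono sub) measurable
    also have "\<dots> \<le> ennreal (exp (- s * t)) * (\<integral>\<^sup>+ \<omega>. ennreal (exp (s * \<sigma> * W \<omega>)) \<partial>M)"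
      using nn_integral_Markov_inequality[of "\<lambda>\<omega>. ennreal (exp (s * \<sigma> * W \<omega>))" "space M" M "ennreal (exp (- s * t))"]
      by (simp add: nn_set_integral_space)
    also have "\<dots> \<le> ennreal (exp (- s * t)) * ennreal (exp (4 * N * s\<^sup>2))"
    proof (intro mult_left_mono)
      have \<sigma>2: "\<sigma>\<^sup>2 = 1" using \<sigma> by (metis one_power2 power2_abs)
      have "\<bar>s * \<sigma>\<bar> \<le> 1/4" using s \<sigma> by (simp add: abs_mult)
      from chi_square_exp_moment_le[OF L ind nrm this]
      show "(\<integral>\<^sup>+ \<omega>. ennreal (exp (s * \<sigma> * W \<omega>)) \<partial>M) \<le> ennreal (exp (4 * N * s\<^sup>2))"
        using \<sigma>2 unfolding W_def N_def by (simp add: power_mult_distrib)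
    qed simp
    also have "\<dots> = ennreal (exp (4 * N * s\<^sup>2 - s * t))"
      by (simp add: ennreal_mult[symmetric] exp_add[symmetric])
    also have "\<dots> \<le> ennreal (exp (- 8 * x))" using st by (intro ennreal_leI) simp
    finally show ?thesis by (simp add: emeasure_eq_measure)
  qed
  have "prob {\<omega> \<in> space M. \<bar>W \<omega>\<bar> \<ge> t} \<le> prob ({\<omega> \<in> space M. 1 * W \<omega> \<ge> t} \<union> {\<omega> \<in> space M. (-1) * W \<omega> \<ge> t})"
    by (intro finite_measure_mono) auto
  also have "\<dots> \<le> prob {\<omega> \<in> space M. 1 * W \<omega> \<ge> t} + prob {\<omega> \<in> space M. (-1) * W \<omega> \<ge> t}"
    by (intro measure_Un_le) auto
  also have "\<dots> \<le> 2 * exp (- 8 * x)" using tail[of 1] tail[of "-1"] by simp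
  finally show ?thesis by (simp add: W_def t_def N_def)
qed

section \<open>Quadratic forms on a net\<close>

text \<open>Two geometric series, each at most 2. This is the factor of one coordinate in the count
  of grid points below.\<close>

lemma sum_half_power_abs_le: "(\<Sum>z\<in>{- int M..int M}. (1/2::real) ^ nat \<bar>z\<bar>) \<le> 4"
proof -
  have geo: "(\<Sum>i\<le>M. (1/2::real) ^ i) \<le> 2"
    by (induction M) (simp_all add: sum_gp0)
  have sub: "{- int M..int M} \<subseteq> int ` {..M} \<union> (\<lambda>i. - int i) ` {..M}"
  proof
    fix z assume "z \<in> {- int M..int M}"
    then show "z \<in> int ` {..M} \<union> (\<lambda>i. - int i) ` {..M}"
      by (cases z rule: int_cases2) auto
  qed
  have "(\<Sum>z\<in>{- int M..int M}. (1/2::real) ^ nat \<bar>z\<bar>) \<le> (\<Sum>z\<in>int ` {..M} \<union> (\<lambda>i. - int i) ` {..M}. (1/2::real) ^ nat \<bar>z\<bar>)"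
    by (intro sum_mono2 sub) auto
  also have "\<dots> \<le> (\<Sum>z\<in>int ` {..M}. (1/2::real) ^ nat \<bar>z\<bar>) + (\<Sum>z\<in>(\<lambda>i. - int i) ` {..M}. (1/2::real) ^ nat \<bar>z\<bar>)"
    by (subst sum.union_inter[symmetric]) (auto intro!: sum_nonneg)
  also have "\<dots> = (\<Sum>i\<le>M. (1/2::real) ^ i) + (\<Sum>i\<le>M. (1/2::real) ^ i)"
    by (subst (1 2) sum.reindex) (auto simp: inj_on_def)
  finally show ?thesis using geo by linarith
qed

text \<open>The net consists of grid points \<open>h * z\<close> with \<open>h = 1 / (8 * sqrt d)\<close> and \<open>z\<close> an integer vector whose
  absolute entries sum to at most \<open>8 * d\<close>; rounding towards zero stays in the ball. They are counted by
  giving \<open>z\<close> the weight \<open>2 ^ (8 * d - \<Sum>a<d. \<bar>z a\<bar>) \<ge> 1\<close>, whose sum over all \<open>z\<close> factorizes.\<close>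

lemma ball_net:
  assumes d: "0 < d"
  shows "\<exists>N :: (nat \<Rightarrow> real) set. finite N \<and> card N \<le> 1024 ^ d \<and>
    (\<forall>u\<in>N. (\<Sum>a<d. (u a)\<^sup>2) \<le> 1) \<and>
    (\<forall>v. (\<Sum>a<d. (v a)\<^sup>2) \<le> 1 \<longrightarrow> (\<exists>u\<in>N. (\<Sum>a<d. (v a - u a)\<^sup>2) \<le> 1/64))"
proof -
  \<comment> \<open>With this mesh \<open>d * h ^ 2 = 1/64\<close>, so moving every coordinate by at
    most \<open>h\<close> moves a point by at most 1/8.\<close>
  define h where "h = 1 / (8 * sqrt d)"
  have h: "h > 0" "h\<^sup>2 = 1 / (64 * d)" using d by (auto simp: h_def power_divide power_mult_distrib)
  define Z where "Z = {z \<in> {..<d} \<rightarrow>\<^sub>E {- int (8*d)..int (8*d)}. (\<Sum>a<d. nat \<bar>z a\<bar>) \<le> 8 * d}"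
  define N where "N = {u \<in> (\<lambda>z a. h * of_int (z a)) ` Z. (\<Sum>a<d. (u a)\<^sup>2) \<le> 1}"
  have fin: "finite ({..<d} \<rightarrow>\<^sub>E {- int (8*d)..int (8*d)})" by (intro finite_PiE) auto
  then have Z: "finite Z" by (simp add: Z_def)
  have "real (card Z) = (\<Sum>z\<in>Z. 1)" by simp
  also have "\<dots> \<le> (\<Sum>z\<in>Z. 2 ^ (8 * d) * (\<Prod>a<d. (1/2::real) ^ nat \<bar>z a\<bar>))"
  proof (intro sum_mono)
    fix z assume "z \<in> Z"
    then have "(2::real) ^ (\<Sum>a<d. nat \<bar>z a\<bar>) \<le> 2 ^ (8 * d)"
      by (intro power_increasing) (auto simp: Z_def)
    moreover have "(\<Prod>a<d. (1/2::real) ^ nat \<bar>z a\<bar>) = 1 / 2 ^ (\<Sum>a<d. nat \<bar>z a\<bar>)"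
      unfolding power_sum[symmetric] by (simp add: power_one_over)
    ultimately show "1 \<le> 2 ^ (8 * d) * (\<Prod>a<d. (1/2::real) ^ nat \<bar>z a\<bar>)"
      by simp
  qed
  also have "\<dots> \<le> (\<Sum>z\<in>{..<d} \<rightarrow>\<^sub>E {- int (8*d)..int (8*d)}. 2 ^ (8 * d) * (\<Prod>a<d. (1/2::real) ^ nat \<bar>z a\<bar>))"
  proof (intro sum_mono2 fin)
    show "Z \<subseteq> {..<d} \<rightarrow>\<^sub>E {- int (8*d)..int (8*d)}" unfolding Z_def by blast
  qed (simp add: prod_nonneg)
  also have "\<dots> = 2 ^ (8 * d) * (\<Prod>a<d. \<Sum>z\<in>{- int (8*d)..int (8*d)}. (1/2::real) ^ nat \<bar>z\<bar>)"
    by (subst prod_sum_PiE) (auto simp: sum_distrib_left)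
  also have "\<dots> \<le> 2 ^ (8 * d) * (\<Prod>a<d. 4)"
    by (intro mult_left_mono prod_mono conjI sum_half_power_abs_le sum_nonneg) auto
  \<comment> \<open>Per coordinate: \<open>2 ^ 8\<close> from the weight and 4 from the sum over
    integers.\<close>
  also have "\<dots> = 1024 ^ d"
    by (simp add: power_mult power_mult_distrib[symmetric])
  finally have "card Z \<le> 1024 ^ d" by (metis of_nat_le_iff of_nat_numeral of_nat_power)
  moreover have "card N \<le> card ((\<lambda>z a. h * of_int (z a)) ` Z)"
    unfolding N_def using Z by (intro card_mono) auto
  moreover have "card ((\<lambda>z a. h * of_int (z a)) ` Z) \<le> card Z" by (rule card_image_le[OF Z])
  ultimately have card: "card N \<le> 1024 ^ d" by linarith
  have finN: "finite N" using Z by (simp add: N_def)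
  have dense: "\<exists>u\<in>N. (\<Sum>a<d. (v a - u a)\<^sup>2) \<le> 1/64" if v: "(\<Sum>a<d. (v a)\<^sup>2) \<le> 1" for v :: "nat \<Rightarrow> real"
  proof -
    define r where "r = (\<lambda>y::real. if 0 \<le> y then \<lfloor>y\<rfloor> else \<lceil>y\<rceil>)"
    have r1: "\<bar>of_int (r y)\<bar> \<le> \<bar>y\<bar>" for y unfolding r_def by (auto; linarith)
    have r2: "\<bar>y - of_int (r y)\<bar> \<le> 1" for y unfolding r_def by (auto; linarith)
    define z where "z = (\<lambda>a\<in>{..<d}. r (v a / h))"
    define u where "u = (\<lambda>a. h * of_int (z a))"
    have zv: "h * \<bar>of_int (z a)\<bar> \<le> \<bar>v a\<bar>" if "a < d" for a
    proof -
      have "h * \<bar>of_int (z a)\<bar> \<le> h * \<bar>v a / h\<bar>"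
        using that h(1) r1[of "v a / h"] by (intro mult_left_mono) (auto simp: z_def)
      also have "\<dots> = \<bar>v a\<bar>" using h(1) by (simp add: abs_divide)
      finally show ?thesis .
    qed
    have uv: "\<bar>u a\<bar> \<le> \<bar>v a\<bar>" if "a < d" for a
      using zv[OF that] h(1) by (simp add: u_def abs_mult)
    have "(\<Sum>a<d. (u a)\<^sup>2) \<le> (\<Sum>a<d. (v a)\<^sup>2)"
      using uv by (intro sum_mono) (simp add: abs_le_square_iff)
    then have u1: "(\<Sum>a<d. (u a)\<^sup>2) \<le> 1" using v by simp
    \<comment> \<open>Cauchy-Schwarz against the constant vector bounds the sum of the absolute
      entries of \<open>v\<close> by \<open>sqrt d\<close>. Dividing by \<open>h\<close> gives the
      constraint \<open>8 * d\<close> imposed on \<open>z\<close>.\<close>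
    have "(\<Sum>a<d. \<bar>v a\<bar> * 1)\<^sup>2 \<le> (\<Sum>a<d. \<bar>v a\<bar>\<^sup>2) * (\<Sum>a<d. 1\<^sup>2)"
      by (rule Cauchy_Schwarz_ineq_sum)
    also have "\<dots> \<le> 1 * real d" using v by (intro mult_mono) (auto intro: sum_nonneg)
    finally have "(\<Sum>a<d. \<bar>v a\<bar>) \<le> sqrt d" by (simp add: real_le_rsqrt)
    moreover have "h * (\<Sum>a<d. \<bar>of_int (z a)\<bar>) \<le> (\<Sum>a<d. \<bar>v a\<bar>)"
      unfolding sum_distrib_left using zv by (intro sum_mono) auto
    ultimately have "h * (\<Sum>a<d. \<bar>of_int (z a)\<bar>) \<le> h * (8 * d)"
      using d by (simp add: h_def real_div_sqrt)
    then have "(\<Sum>a<d. \<bar>of_int (z a)\<bar>) \<le> real (8 * d)" using h(1) by simp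
    moreover have "(\<Sum>a<d. \<bar>of_int (z a)\<bar>) = real (\<Sum>a<d. nat \<bar>z a\<bar>)" by simp
    ultimately have zs: "(\<Sum>a<d. nat \<bar>z a\<bar>) \<le> 8 * d" by (metis of_nat_le_iff)
    have "z a \<in> {- int (8*d)..int (8*d)}" if "a < d" for a
    proof -
      have "nat \<bar>z a\<bar> \<le> (\<Sum>a<d. nat \<bar>z a\<bar>)" using that by (intro member_le_sum) auto
      then show ?thesis using zs by auto
    qed
    then have "z \<in> Z" using zs by (auto simp: Z_def z_def)
    then have uN: "u \<in> N" using u1 by (auto simp: N_def u_def)
    have "(\<Sum>a<d. (v a - u a)\<^sup>2) \<le> (\<Sum>a<d. h\<^sup>2)"
    proof (intro sum_mono)
      fix a assume a: "a \<in> {..<d}"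
      have "v a - u a = h * (v a / h - of_int (r (v a / h)))"
        using a h(1) by (simp add: u_def z_def right_diff_distrib)
      then have "\<bar>v a - u a\<bar> = h * \<bar>v a / h - of_int (r (v a / h))\<bar>"
        using h(1) by (simp add: abs_mult)
      also have "\<dots> \<le> h * 1" using h(1) r2 by (intro mult_left_mono) auto
      finally show "(v a - u a)\<^sup>2 \<le> h\<^sup>2" using h(1) by (simp add: abs_le_square_iff[symmetric])
    qed
    also have "(\<Sum>a<d. h\<^sup>2) = 1/64" unfolding h(2) using d by simp
    finally show ?thesis using uN by blast
  qed
  show ?thesis
    using card dense finN by (intro exI[of _ N]) (auto simp: N_def)
qed

text \<open>Let \<open>S\<close> be the supremum of \<open>|B v v|\<close> over the unit ball.
  Replacing \<open>v\<close> by a net point \<open>u\<close> changes the form by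
  \<open>B (v - u) (v + u)\<close>, which is at most \<open>S / 4\<close>; so
  \<open>S \<le> t + S / 4\<close>. The constant \<open>K\<close> does not enter the conclusion: it
  makes \<open>S\<close> finite and lets the form vanish where the norm does.\<close>

lemma quadratic_form_bound_from_net:
  fixes B :: "(nat \<Rightarrow> real) \<Rightarrow> (nat \<Rightarrow> real) \<Rightarrow> real"
  assumes sym: "\<And>u v. B u v = B v u"
    and add: "\<And>u v w. B (\<lambda>a. u a + v a) w = B u w + B v w"
    and scale: "\<And>c u w. B (\<lambda>a. c * u a) w = c * B u w"
    and bounded: "\<And>v. \<bar>B v v\<bar> \<le> K * (\<Sum>a<d. (v a)\<^sup>2)"
    and N: "\<And>u. u \<in> N \<Longrightarrow> (\<Sum>a<d. (u a)\<^sup>2) \<le> 1"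
    and dense: "\<And>v. (\<Sum>a<d. (v a)\<^sup>2) \<le> 1 \<Longrightarrow> \<exists>u\<in>N. (\<Sum>a<d. (v a - u a)\<^sup>2) \<le> 1/64"
    and t: "\<And>u. u \<in> N \<Longrightarrow> \<bar>B u u\<bar> \<le> t"
  shows "\<bar>B v v\<bar> \<le> 2 * t * (\<Sum>a<d. (v a)\<^sup>2)"
proof -
  let ?q = "\<lambda>v. \<Sum>a<d. (v a)\<^sup>2 :: real"
  define ball where "ball = {v :: nat \<Rightarrow> real. ?q v \<le> 1}"
  define S where "S = (SUP v\<in>ball. \<bar>B v v\<bar>)"
  have zero: "(\<lambda>_. 0) \<in> ball" by (simp add: ball_def)
  have bdd: "bdd_above ((\<lambda>v. \<bar>B v v\<bar>) ` ball)"
  proof (rule bdd_aboveI2)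
    fix v assume "v \<in> ball"
    then have "K * ?q v \<le> \<bar>K\<bar> * 1"
      by (intro mult_mono) (auto simp: ball_def intro: sum_nonneg)
    then show "\<bar>B v v\<bar> \<le> \<bar>K\<bar>" using bounded[of v] by linarith
  qed
  have S: "\<bar>B v v\<bar> \<le> S" if "v \<in> ball" for v
    unfolding S_def using bdd that by (rule cSUP_upper2) auto
  have S0: "0 \<le> S" using S[OF zero] by linarith
  have scale2: "B (\<lambda>a. c * u a) (\<lambda>a. c * u a) = c\<^sup>2 * B u u" for c u
    unfolding scale sym[of u "\<lambda>a. c * u a"] by (simp add: power2_eq_square)
  have hom: "\<bar>B v v\<bar> \<le> S * ?q v" for v
  proof (cases "?q v = 0")
    case True
    then show ?thesis using bounded[of v] by simp
  next
    case False
    then have q: "?q v > 0" by (simp add: less_le sum_nonneg)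
    define c where "c = 1 / sqrt (?q v)"
    have c2: "c\<^sup>2 = 1 / ?q v" using q by (simp add: c_def power_divide)
    have "?q (\<lambda>a. c * v a) = c\<^sup>2 * ?q v" by (simp add: power_mult_distrib sum_distrib_left)
    then have "(\<lambda>a. c * v a) \<in> ball" using q by (simp add: ball_def c2)
    from S[OF this] have "c\<^sup>2 * \<bar>B v v\<bar> \<le> S" unfolding scale2 by (simp add: abs_mult)
    then show ?thesis using q by (simp add: c2 field_simps)
  qed
  have "\<bar>B v v\<bar> \<le> t + S / 4" if v: "v \<in> ball" for v
  proof -
    obtain u where u: "u \<in> N" and vu: "?q (\<lambda>a. v a - u a) \<le> 1/64"
      using dense[of v] v by (auto simp: ball_def)
    \<comment> \<open>The factors 4 and 1/4 cancel in \<open>B p w\<close> and balance the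
      arguments: \<open>v - u\<close> has norm at most 1/8 and \<open>v + u\<close> at most 2, so
      \<open>p\<close> and \<open>w\<close> both have norm at most 1/2.\<close>
    define p where "p = (\<lambda>a. 4 * (v a - u a))"
    define w where "w = (\<lambda>a. (v a + u a) / 4)"
    have diff: "B (\<lambda>a. u a - v a) w = B u w - B v w" for u v w
      using add[of u "\<lambda>a. (-1) * v a" w] scale[of "-1" v w] by simp
    have addr: "B w (\<lambda>a. u a + v a) = B w u + B w v" and diffr: "B w (\<lambda>a. u a - v a) = B w u - B w v" for u v w
      using add[of u v w] diff[of u v w] by (simp_all add: sym[of w])
    have "B v v - B u u = B (\<lambda>a. v a - u a) (\<lambda>a. v a + u a)"
      unfolding diff addr using sym[of u v] by simp
    also have "\<dots> = B p w"
    proof -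
      have "B p w = 4 * B (\<lambda>a. v a - u a) (\<lambda>a. (1/4) * (v a + u a))"
        unfolding p_def w_def scale by simp
      also have "\<dots> = B (\<lambda>a. v a - u a) (\<lambda>a. v a + u a)"
        unfolding sym[of "\<lambda>a. v a - u a"] scale by simp
      finally show ?thesis by simp
    qed
    finally have e: "B v v - B u u = B p w" .
    \<comment> \<open>Polarization reduces the mixed term to diagonal ones, where \<open>hom\<close>
      applies; the parallelogram law then adds the two squared norms to at most 1.\<close>
    have "4 * B p w = B (\<lambda>a. p a + w a) (\<lambda>a. p a + w a) - B (\<lambda>a. p a - w a) (\<lambda>a. p a - w a)"
      unfolding add diff addr diffr using sym[of w p] by simp
    then have "4 * \<bar>B p w\<bar> \<le> \<bar>B (\<lambda>a. p a + w a) (\<lambda>a. p a + w a)\<bar> + \<bar>B (\<lambda>a. p a - w a) (\<lambda>a. p a - w a)\<bar>"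
      by linarith
    also have "\<dots> \<le> S * (?q (\<lambda>a. p a + w a) + ?q (\<lambda>a. p a - w a))"
      using hom[of "\<lambda>a. p a + w a"] hom[of "\<lambda>a. p a - w a"] by (simp add: distrib_left)
    also have "?q (\<lambda>a. p a + w a) + ?q (\<lambda>a. p a - w a) = 2 * ?q p + 2 * ?q w"
      by (simp add: sum.distrib[symmetric] sum_distrib_left power2_eq_square algebra_simps)
    also have "?q p = 16 * ?q (\<lambda>a. v a - u a)"
      unfolding p_def power_mult_distrib sum_distrib_left by simp
    also have "?q w = ?q (\<lambda>a. v a + u a) / 16"
      by (simp add: w_def power_divide sum_divide_distrib)
    also have "S * (2 * (16 * ?q (\<lambda>a. v a - u a)) + 2 * (?q (\<lambda>a. v a + u a) / 16)) \<le> S * 1"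
    proof (intro mult_left_mono S0)
      have "?q (\<lambda>a. v a + u a) \<le> (\<Sum>a<d. 2 * (v a)\<^sup>2 + 2 * (u a)\<^sup>2)"
        by (intro sum_mono) (smt (verit) power2_sum sum_squares_bound)
      also have "\<dots> = 2 * ?q v + 2 * ?q u" by (simp add: sum.distrib sum_distrib_left)
      also have "\<dots> \<le> 4" using v N[OF u] by (simp add: ball_def)
      finally show "2 * (16 * ?q (\<lambda>a. v a - u a)) + 2 * (?q (\<lambda>a. v a + u a) / 16) \<le> 1"
        using vu by simp
    qed
    finally have "\<bar>B p w\<bar> \<le> S / 4" by simp
    then show ?thesis using e t[OF u] by linarith
  qed
  then have "S \<le> t + S / 4"
    unfolding S_def using zero by (intro cSUP_least) auto
  then have "S \<le> 2 * t" using S0 by linarith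
  then have "S * ?q v \<le> 2 * t * ?q v" by (intro mult_right_mono) (auto intro: sum_nonneg)
  then show ?thesis using hom[of v] by linarith
qed

section \<open>Gaussian quadratic forms\<close>

lemma prob_space_PiM_std_normal: "prob_space (\<Pi>\<^sub>M p\<in>I. std_normal_distribution)"
  by (intro prob_space_PiM prob_space_normal_density) simp

lemma sets_PiM_std_normal:
  "sets (\<Pi>\<^sub>M p\<in>I. std_normal_distribution) = sets (\<Pi>\<^sub>M p\<in>I. (borel :: real measure))"
  by (intro sets_PiM_cong) auto

lemma measurable_PiM_std_normal_component:
  "p \<in> I \<Longrightarrow> (\<lambda>\<omega>. \<omega> p) \<in> borel_measurable (\<Pi>\<^sub>M p\<in>I. std_normal_distribution)"
  unfolding measurable_cong_sets[OF sets_PiM_std_normal refl] by measurable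

lemma distributed_PiM_std_normal_component:
  assumes "p \<in> I"
  shows "distributed (\<Pi>\<^sub>M p\<in>I. std_normal_distribution) lborel (\<lambda>\<omega>. \<omega> p) std_normal_density"
proof -
  have "distr (\<Pi>\<^sub>M p\<in>I. std_normal_distribution) lborel (\<lambda>\<omega>. \<omega> p) =
      distr (\<Pi>\<^sub>M p\<in>I. std_normal_distribution) std_normal_distribution (\<lambda>\<omega>. \<omega> p)"
    by (intro distr_cong) auto
  also have "\<dots> = std_normal_distribution"
    by (rule distr_PiM_component[where M = "\<lambda>_. std_normal_distribution", OF _ assms])
      (rule prob_space_normal_density, simp)
  finally have "distr (\<Pi>\<^sub>M p\<in>I. std_normal_distribution) lborel (\<lambda>\<omega>. \<omega> p) = std_normal_distribution" .
  moreover have "(\<lambda>\<omega>. \<omega> p) \<in> measurable (\<Pi>\<^sub>M p\<in>I. std_normal_distribution) lborel"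
    using measurable_PiM_std_normal_component[OF assms] unfolding measurable_lborel1 .
  ultimately show ?thesis unfolding distributed_def by (intro conjI) auto
qed

lemma indep_vars_PiM_std_normal_components:
  assumes "I \<noteq> {}"
  shows "prob_space.indep_vars (\<Pi>\<^sub>M p\<in>I. std_normal_distribution) (\<lambda>_. borel) (\<lambda>p \<omega>. \<omega> p) I"
proof -
  let ?P = "\<Pi>\<^sub>M p\<in>I. std_normal_distribution"
  interpret prob_space ?P by (rule prob_space_PiM_std_normal)
  have "distr ?P (\<Pi>\<^sub>M p\<in>I. borel) (\<lambda>\<omega>. \<lambda>p\<in>I. \<omega> p) = distr ?P (\<Pi>\<^sub>M p\<in>I. borel) (\<lambda>\<omega>. \<omega>)"
    by (intro distr_cong) (auto simp: space_PiM)
  also have "\<dots> = ?P" by (intro distr_id2) (simp add: sets_PiM_std_normal)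
  also have "\<dots> = (\<Pi>\<^sub>M p\<in>I. distr ?P borel (\<lambda>\<omega>. \<omega> p))"
  proof (rule PiM_cong[OF refl])
    fix p assume "p \<in> I"
    have "distr ?P borel (\<lambda>\<omega>. \<omega> p) = distr ?P lborel (\<lambda>\<omega>. \<omega> p)" by (intro distr_cong) auto
    then show "std_normal_distribution = distr ?P borel (\<lambda>\<omega>. \<omega> p)"
      using distributed_distr_eq_density[OF distributed_PiM_std_normal_component[OF \<open>p \<in> I\<close>]] by (rule trans[symmetric])
  qed
  finally show ?thesis
    using assms by (subst indep_vars_iff_distr_eq_PiM') auto
qed

text \<open>Disjoint blocks of independent coordinates are independent, and a combination of
  independent standard normals with unit coefficient vector is again standard normal.\<close>

lemma std_normal_combinations:
  fixes c :: "'p \<Rightarrow> real"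
  assumes I: "finite I" "I \<noteq> {}" and K: "\<And>l. l \<in> L \<Longrightarrow> K l \<subseteq> I" and disj: "disjoint_family_on K L"
    and c: "\<And>l. l \<in> L \<Longrightarrow> (\<Sum>p\<in>K l. (c p)\<^sup>2) = 1"
  defines "P \<equiv> \<Pi>\<^sub>M p\<in>I. std_normal_distribution"
  shows "prob_space.indep_vars P (\<lambda>_. borel) (\<lambda>l \<omega>. \<Sum>p\<in>K l. c p * \<omega> p) L"
    and "\<And>l. l \<in> L \<Longrightarrow> distributed P lborel (\<lambda>\<omega>. \<Sum>p\<in>K l. c p * \<omega> p) std_normal_density"
proof -
  interpret prob_space P unfolding P_def by (rule prob_space_PiM_std_normal)
  have ind: "indep_vars (\<lambda>_. borel) (\<lambda>p \<omega>. \<omega> p) I"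
    unfolding P_def by (rule indep_vars_PiM_std_normal_components[OF I(2)])
  have "indep_vars (\<lambda>_. borel) (\<lambda>l \<omega>. (\<lambda>f. \<Sum>p\<in>K l. c p * f p) (restrict (\<lambda>p. \<omega> p) (K l))) L"
    by (rule indep_vars_compose2[OF indep_vars_restrict[OF ind K disj]]) auto
  then show "indep_vars (\<lambda>_. borel) (\<lambda>l \<omega>. \<Sum>p\<in>K l. c p * \<omega> p) L"
    by simp
  fix l assume l: "l \<in> L"
  \<comment> \<open>The summation theorem for independent normals asks for positive standard
    deviations, so zero coefficients are dropped first.\<close>
  define J where "J = {p \<in> K l. c p \<noteq> 0}"
  have JI: "J \<subseteq> I" and fin: "finite (K l)" "finite J"
    using K[OF l] I(1) by (auto simp: J_def intro: finite_subset)
  have sumJ: "(\<Sum>p\<in>K l. g p * c p) = (\<Sum>p\<in>J. g p * c p)" for g :: "'p \<Rightarrow> real"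
    unfolding J_def using fin by (intro sum.mono_neutral_right) auto
  have cJ: "(\<Sum>p\<in>J. (c p)\<^sup>2) = 1"
    using c[OF l] sumJ[of c] by (simp add: power2_eq_square)
  then have "J \<noteq> {}" by auto
  have "distributed P lborel (\<lambda>\<omega>. \<Sum>p\<in>J. c p * \<omega> p) (normal_density (\<Sum>p\<in>J. 0) (sqrt (\<Sum>p\<in>J. \<bar>c p\<bar>\<^sup>2)))"
  proof (intro sum_indep_normal fin \<open>J \<noteq> {}\<close>)
    show "indep_vars (\<lambda>_. borel) (\<lambda>p \<omega>. c p * \<omega> p) J"
      using indep_vars_compose2[OF indep_vars_subset[OF ind JI], of "\<lambda>p z. c p * z" "\<lambda>_. borel"] by simp
    fix p assume p: "p \<in> J"
    then show "0 < \<bar>c p\<bar>" by (simp add: J_def)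
    have "distributed P lborel (\<lambda>\<omega>. \<omega> p) (normal_density 0 1)"
      unfolding P_def using p JI by (intro distributed_PiM_std_normal_component) auto
    from normal_density_affine[OF this, of "c p" 0]
    show "distributed P lborel (\<lambda>\<omega>. c p * \<omega> p) (normal_density 0 \<bar>c p\<bar>)"
      using p by (simp add: J_def)
  qed
  moreover have "(\<Sum>p\<in>J. c p * \<omega> p) = (\<Sum>p\<in>K l. c p * \<omega> p)" for \<omega>
    using sumJ[of \<omega>] by (simp add: mult.commute)
  ultimately show "distributed P lborel (\<lambda>\<omega>. \<Sum>p\<in>K l. c p * \<omega> p) std_normal_density"
    by (simp add: cJ)
qed

text \<open>The map \<open>\<phi>\<close> arranges coordinates in an array with rows
  \<open>L\<close> and \<open>d\<close> columns. Its injectivity makes the entries distinct, so the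
  products of the rows with the unit vector \<open>w\<close> are independent standard normals and
  their squares add up to a chi-square variable.\<close>

lemma gaussian_quadratic_form_tail:
  fixes w :: "nat \<Rightarrow> real" and \<phi> :: "'l \<times> nat \<Rightarrow> 'p" and x :: real
  assumes I: "finite I" "I \<noteq> {}" and L: "finite L"
    and inj: "inj_on \<phi> (L \<times> {..<d})" and img: "\<phi> ` (L \<times> {..<d}) \<subseteq> I"
    and w: "(\<Sum>a<d. (w a)\<^sup>2) = 1" and x: "0 \<le> x"
  defines "P \<equiv> \<Pi>\<^sub>M p\<in>I. std_normal_distribution"
  shows "measure P {\<omega> \<in> space P. 48 * (sqrt (card L * x) + x) \<le>
      \<bar>(\<Sum>l\<in>L. (\<Sum>a<d. w a * \<omega> (\<phi> (l, a)))\<^sup>2) - card L\<bar>} \<le> 2 * exp (- 8 * x)"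
proof -
  interpret prob_space P unfolding P_def by (rule prob_space_PiM_std_normal)
  define K where "K = (\<lambda>l. \<phi> ` ({l} \<times> {..<d}))"
  \<comment> \<open>Coefficients have to be indexed by coordinates here, so \<open>w\<close> is
    transported along the inverse of \<open>\<phi>\<close>.\<close>
  define c where "c = (\<lambda>p. w (snd (inv_into (L \<times> {..<d}) \<phi> p)))"
  have reidx: "(\<Sum>p\<in>K l. g p) = (\<Sum>a<d. g (\<phi> (l, a)))" if "l \<in> L" for l and g :: "'p \<Rightarrow> real"
  proof -
    have "K l = (\<lambda>a. \<phi> (l, a)) ` {..<d}" by (auto simp: K_def)
    moreover have "inj_on (\<lambda>a. \<phi> (l, a)) {..<d}" using inj that by (auto simp: inj_on_def)
    ultimately show ?thesis by (simp add: sum.reindex)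
  qed
  have c: "c (\<phi> (l, a)) = w a" if "l \<in> L" "a < d" for l a
    using that by (simp add: c_def inv_into_f_f[OF inj])
  have KI: "K l \<subseteq> I" if "l \<in> L" for l using img that by (auto simp: K_def)
  have disj: "disjoint_family_on K L"
    by (auto simp: disjoint_family_on_def K_def dest!: inj_onD[OF inj])
  have c1: "(\<Sum>p\<in>K l. (c p)\<^sup>2) = 1" if "l \<in> L" for l
    using w that by (simp add: reidx c)
  have "prob {\<omega> \<in> space P. 48 * (sqrt (card L * x) + x) \<le>
      \<bar>(\<Sum>l\<in>L. (\<Sum>p\<in>K l. c p * \<omega> p)\<^sup>2) - card L\<bar>} \<le> 2 * exp (- 8 * x)"
    using std_normal_combinations[where c = c and K = K and L = L, OF I KI disj c1] x unfolding P_def[symmetric]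
    by (intro chi_square_tail[where Z = "\<lambda>l \<omega>. \<Sum>p\<in>K l. c p * \<omega> p"] L) auto
  moreover have "(\<Sum>l\<in>L. (\<Sum>p\<in>K l. c p * \<omega> p)\<^sup>2) = (\<Sum>l\<in>L. (\<Sum>a<d. w a * \<omega> (\<phi> (l, a)))\<^sup>2)" for \<omega>
    by (intro sum.cong refl) (simp add: reidx c)
  ultimately show ?thesis by simp
qed

text \<open>A union bound over the at most \<open>1024 ^ d\<close> net points, followed by the
  passage from the net to all \<open>w\<close>, which doubles 48 to 96. The exceptional set is named
  explicitly: as a finite union it is measurable, whereas the condition on all \<open>w\<close> is
  an uncountable intersection.\<close>

lemma gaussian_quadratic_form_uniform:
  fixes \<phi> :: "'l \<times> nat \<Rightarrow> 'p" and x :: real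
  assumes I: "finite I" "I \<noteq> {}" and L: "finite L"
    and inj: "inj_on \<phi> (L \<times> {..<d})" and img: "\<phi> ` (L \<times> {..<d}) \<subseteq> I"
    and d: "0 < d" and x: "0 \<le> x"
  defines "P \<equiv> \<Pi>\<^sub>M p\<in>I. std_normal_distribution"
  shows "\<exists>bad. bad \<in> sets P \<and> measure P bad \<le> 2 * 1024 ^ d * exp (- 8 * x) \<and>
    (\<forall>\<omega> (w :: nat \<Rightarrow> real). \<omega> \<in> space P - bad \<longrightarrow>
      \<bar>(\<Sum>l\<in>L. (\<Sum>a<d. w a * \<omega> (\<phi> (l, a)))\<^sup>2) - card L * (\<Sum>a<d. (w a)\<^sup>2)\<bar>
        \<le> 96 * (sqrt (card L * x) + x) * (\<Sum>a<d. (w a)\<^sup>2))"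
proof -
  interpret prob_space P unfolding P_def by (rule prob_space_PiM_std_normal)
  define t where "t = 48 * (sqrt (card L * x) + x)"
  have t0: "0 \<le> t" using x by (simp add: t_def)
  define q where "q = (\<lambda>w. \<Sum>a<d. (w a)\<^sup>2 :: real)"
  define B where "B = (\<lambda>\<omega> u v. (\<Sum>l\<in>L. (\<Sum>a<d. u a * \<omega> (\<phi> (l, a))) * (\<Sum>a<d. v a * \<omega> (\<phi> (l, a))))
      - card L * (\<Sum>a<d. u a * v a :: real))"
  obtain N :: "(nat \<Rightarrow> real) set" where N: "finite N" "card N \<le> 1024 ^ d"
    "\<And>u. u \<in> N \<Longrightarrow> (\<Sum>a<d. (u a)\<^sup>2) \<le> 1"
    "\<And>v. (\<Sum>a<d. (v a)\<^sup>2) \<le> 1 \<Longrightarrow> \<exists>u\<in>N. (\<Sum>a<d. (v a - u a)\<^sup>2) \<le> 1/64"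
    using ball_net[OF d] by auto
  define nrm where "nrm = (\<lambda>u a. u a / sqrt (q u))"
  define E where "E = (\<lambda>u. {\<omega> \<in> space P. t \<le> \<bar>B \<omega> (nrm u) (nrm u)\<bar>})"
  \<comment> \<open>The tail bound concerns unit vectors, so net points are normalised. The form at
    \<open>u\<close> is \<open>q u\<close> times the form at \<open>nrm u\<close>, and
    \<open>q u \<le> 1\<close>, so the threshold survives; at points with \<open>q u = 0\<close> the
    form is 0.\<close>
  define bad where "bad = (\<Union>u\<in>{u\<in>N. q u \<noteq> 0}. E u)"
  have q0: "0 \<le> q w" for w by (simp add: q_def sum_nonneg)
  have qnrm: "q (nrm u) = 1" if "q u \<noteq> 0" for u
  proof -
    have "q (nrm u) = q u / (sqrt (q u))\<^sup>2"
      by (simp only: q_def nrm_def power_divide sum_divide_distrib)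
    then show ?thesis using q0[of u] that by simp
  qed
  have \<phi>I: "\<phi> (l, a) \<in> I" if "l \<in> L" "a < d" for l a using img that by auto
  have [measurable]: "(\<lambda>\<omega>. B \<omega> u v) \<in> borel_measurable P" for u v
  proof -
    have "(\<lambda>\<omega>. \<Sum>a<d. z a * \<omega> (\<phi> (l, a))) \<in> borel_measurable P" if "l \<in> L" for z l
      unfolding P_def using \<phi>I[OF that]
      by (intro borel_measurable_sum borel_measurable_times[OF borel_measurable_const]
          measurable_PiM_std_normal_component) simp
    then show ?thesis
      unfolding B_def by (intro borel_measurable_diff borel_measurable_sum[where S = L] borel_measurable_times borel_measurable_const)
  qed
  have E: "E u \<in> sets P" for u unfolding E_def by measurable
  have PE: "prob (E u) \<le> 2 * exp (- 8 * x)" if "q u \<noteq> 0" for u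
  proof -
    have "B \<omega> (nrm u) (nrm u) = (\<Sum>l\<in>L. (\<Sum>a<d. nrm u a * \<omega> (\<phi> (l, a)))\<^sup>2) - card L" for \<omega>
      using qnrm[OF that] by (simp add: B_def q_def power2_eq_square)
    then show ?thesis
      unfolding E_def t_def using gaussian_quadratic_form_tail[OF I L inj img _ x, of "nrm u"] qnrm[OF that]
      unfolding P_def[symmetric] q_def by simp
  qed
  have bad: "bad \<in> sets P" unfolding bad_def using N(1) E by auto
  have "prob bad \<le> (\<Sum>u\<in>{u\<in>N. q u \<noteq> 0}. prob (E u))"
    unfolding bad_def using N(1) E by (intro finite_measure_subadditive_finite) auto
  also have "\<dots> \<le> (\<Sum>u\<in>{u\<in>N. q u \<noteq> 0}. 2 * exp (- 8 * x))"
    by (intro sum_mono PE) auto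
  also have "\<dots> \<le> real (1024 ^ d) * (2 * exp (- 8 * x))"
  proof -
    have "card {u\<in>N. q u \<noteq> 0} \<le> card N" using N(1) by (intro card_mono) auto
    then have "real (card {u\<in>N. q u \<noteq> 0}) \<le> real (1024 ^ d)" using N(2) by linarith
    then show ?thesis by (simp del: of_nat_power)
  qed
  finally have pbad: "prob bad \<le> 2 * 1024 ^ d * exp (- 8 * x)" by (simp add: mult_ac)
  have "\<bar>(\<Sum>l\<in>L. (\<Sum>a<d. w a * \<omega> (\<phi> (l, a)))\<^sup>2) - card L * (\<Sum>a<d. (w a)\<^sup>2)\<bar>
        \<le> 96 * (sqrt (card L * x) + x) * (\<Sum>a<d. (w a)\<^sup>2)"
    if \<omega>: "\<omega> \<in> space P - bad" for \<omega> and w :: "nat \<Rightarrow> real"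
  proof -
    \<comment> \<open>A crude Cauchy-Schwarz constant depending on \<open>\<omega>\<close>; only its
      finiteness matters.\<close>
    define Y where "Y = (\<lambda>l. \<Sum>a<d. (\<omega> (\<phi> (l, a)))\<^sup>2)"
    have Bq: "B \<omega> v v = (\<Sum>l\<in>L. (\<Sum>a<d. v a * \<omega> (\<phi> (l, a)))\<^sup>2) - card L * q v" for v
      by (simp add: B_def q_def power2_eq_square)
    have "\<bar>B \<omega> w w\<bar> \<le> 2 * t * (\<Sum>a<d. (w a)\<^sup>2)"
    proof (rule quadratic_form_bound_from_net[where B = "B \<omega>" and N = N and K = "(\<Sum>l\<in>L. Y l) + card L"])
      show "B \<omega> u v = B \<omega> v u" for u v by (simp add: B_def mult_ac)
      show "B \<omega> (\<lambda>a. u a + v a) w = B \<omega> u w + B \<omega> v w" for u v w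
        by (simp add: B_def distrib_right sum.distrib distrib_left)
      show "B \<omega> (\<lambda>a. c * u a) w = c * B \<omega> u w" for c u w
        by (simp add: B_def sum_distrib_left right_diff_distrib mult_ac)
      fix v :: "nat \<Rightarrow> real"
      have "(\<Sum>l\<in>L. (\<Sum>a<d. v a * \<omega> (\<phi> (l, a)))\<^sup>2) \<le> (\<Sum>l\<in>L. q v * Y l)"
        unfolding q_def Y_def by (intro sum_mono Cauchy_Schwarz_ineq_sum)
      moreover have "0 \<le> (\<Sum>l\<in>L. (\<Sum>a<d. v a * \<omega> (\<phi> (l, a)))\<^sup>2)" by (intro sum_nonneg) simp
      moreover have "0 \<le> card L * q v" using q0 by simp
      moreover have "(\<Sum>l\<in>L. q v * Y l) + card L * q v = ((\<Sum>l\<in>L. Y l) + card L) * q v"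
        using sum_distrib_left[of "q v" Y L] by (simp add: algebra_simps)
      ultimately show "\<bar>B \<omega> v v\<bar> \<le> ((\<Sum>l\<in>L. Y l) + card L) * (\<Sum>a<d. (v a)\<^sup>2)"
        unfolding Bq q_def[THEN fun_cong, symmetric] by linarith
    next
      fix u assume u: "u \<in> N"
      show "\<bar>B \<omega> u u\<bar> \<le> t"
      proof (cases "q u = 0")
        case True
        then have "\<forall>a<d. u a = 0" unfolding q_def by (subst (asm) sum_nonneg_eq_0_iff) auto
        then show ?thesis using t0 by (simp add: B_def)
      next
        case False
        then have "\<omega> \<notin> E u" using \<omega> u by (auto simp: bad_def)
        then have 1: "\<bar>B \<omega> (nrm u) (nrm u)\<bar> \<le> t" using \<omega> by (auto simp: E_def)
        have "(\<Sum>a<d. nrm u a * \<omega> (\<phi> (l, a)))\<^sup>2 = (\<Sum>a<d. u a * \<omega> (\<phi> (l, a)))\<^sup>2 / q u" for l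
        proof -
          have "(\<Sum>a<d. nrm u a * \<omega> (\<phi> (l, a))) = (\<Sum>a<d. u a * \<omega> (\<phi> (l, a))) / sqrt (q u)"
            by (simp add: nrm_def sum_divide_distrib)
          then show ?thesis using q0 by (simp add: power_divide)
        qed
        then have "B \<omega> (nrm u) (nrm u) = B \<omega> u u / q u"
          unfolding Bq qnrm[OF False] using False by (simp add: sum_divide_distrib[symmetric] diff_divide_distrib)
        then have "\<bar>B \<omega> u u\<bar> = \<bar>B \<omega> (nrm u) (nrm u)\<bar> * q u"
          using False q0[of u] by (simp add: abs_divide)
        also have "\<dots> \<le> t * 1" using 1 t0 N(3)[OF u] q0 by (intro mult_mono) (auto simp: q_def)
        finally show ?thesis by simp
      qed
    qed (use N(3,4) in auto)
    then show ?thesis by (simp add: Bq t_def q_def)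
  qed
  with bad pbad show ?thesis by (intro exI[of _ bad] conjI allI impI)
qed

text \<open>Join distinct \<open>l\<close> and \<open>l'\<close> when \<open>i l = j l'\<close>. By
  injectivity every vertex has at most one neighbour in each direction, so the degree is at most 2
  and greedy colouring gets by with three colours.\<close>

lemma index_shift_colouring:
  fixes i j :: "'l \<Rightarrow> 'b"
  assumes "finite L" "inj_on i L" "inj_on j L"
  shows "\<exists>f :: 'l \<Rightarrow> nat. (\<forall>l\<in>L. f l < 3) \<and> (\<forall>l\<in>L. \<forall>l'\<in>L. l \<noteq> l' \<longrightarrow> i l = j l' \<longrightarrow> f l \<noteq> f l')"
  using assms
proof (induction L rule: finite_induct)
  case empty
  show ?case by simp
next
  case (insert l L)
  then obtain f :: "'l \<Rightarrow> nat" where f: "\<forall>l\<in>L. f l < 3" "\<forall>l\<in>L. \<forall>l'\<in>L. l \<noteq> l' \<longrightarrow> i l = j l' \<longrightarrow> f l \<noteq> f l'"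
    by (auto simp: inj_on_insert)
  \<comment> \<open>\<open>a\<close> and \<open>b\<close> are the only possible neighbours of the
    new index, and arbitrary if there is none; a colour different from both of theirs
    remains.\<close>
  obtain a where a: "\<And>l'. l' \<in> L \<Longrightarrow> i l = j l' \<Longrightarrow> l' = a"
    using insert.prems(2) by (metis inj_onD insertI2)
  obtain b where b: "\<And>l'. l' \<in> L \<Longrightarrow> i l' = j l \<Longrightarrow> l' = b"
    using insert.prems(1) by (metis inj_onD insertI2)
  have "\<exists>c::nat. c < 3 \<and> c \<noteq> f a \<and> c \<noteq> f b" by presburger
  then obtain c :: nat where c: "c < 3" "c \<noteq> f a" "c \<noteq> f b" by blast
  have "(f(l := c)) k \<noteq> (f(l := c)) k'" if "k \<in> insert l L" "k' \<in> insert l L" "k \<noteq> k'" "i k = j k'" for k k'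
    using that f(2) a[of k'] b[of k] c by auto
  moreover have "(f(l := c)) k < 3" if "k \<in> insert l L" for k
    using that f(1) c(1) by auto
  ultimately show ?case by blast
qed

text \<open>Rows with \<open>i l = j l\<close> depend only on \<open>y - y'\<close>. The remaining rows are correlated through coincidences
  \<open>i l = j l'\<close>; a colouring splits them into three classes of independent rows.\<close>

lemma selection_pair_concentration:
  fixes i j :: "nat \<Rightarrow> nat" and x :: real
  assumes k: "0 < k" and i: "inj_on i {..<m}" "\<And>l. l < m \<Longrightarrow> i l < n"
    and j: "inj_on j {..<m}" "\<And>l. l < m \<Longrightarrow> j l < n"
    and n: "0 < n" and x: "0 \<le> x"
  defines "Q \<equiv> {l\<in>{..<m}. i l = j l}" and "R \<equiv> {l\<in>{..<m}. i l \<noteq> j l}"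
  shows "\<exists>bad\<in>sets (gaussian_entries n k). measure (gaussian_entries n k) bad \<le> 8 * 1024 ^ (2 * k) * exp (- 8 * x) \<and>
    (\<forall>\<omega> \<in> space (gaussian_entries n k) - bad. \<forall>y y' :: nat \<Rightarrow> real.
      \<bar>(\<Sum>l<m. ((\<Sum>a<k. y a * \<omega> (i l, a)) - (\<Sum>a<k. y' a * \<omega> (j l, a)))\<^sup>2)
        - (card Q * (\<Sum>a<k. (y a - y' a)\<^sup>2) + card R * ((\<Sum>a<k. (y a)\<^sup>2) + (\<Sum>a<k. (y' a)\<^sup>2)))\<bar>
      \<le> 96 * (sqrt (card Q * x) + x) * (\<Sum>a<k. (y a - y' a)\<^sup>2)
        + 288 * (sqrt (card R * x) + x) * ((\<Sum>a<k. (y a)\<^sup>2) + (\<Sum>a<k. (y' a)\<^sup>2)))"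
proof -
  let ?I = "{..<n} \<times> {..<k}"
  let ?P = "gaussian_entries n k"
  interpret prob_space ?P unfolding gaussian_entries_def by (rule prob_space_PiM_std_normal)
  have I: "finite ?I" "?I \<noteq> {}" using n k by auto
  have fin: "finite Q" "finite R" by (simp_all add: Q_def R_def)
  have inR: "inj_on i R" "inj_on j R" using i j by (auto simp: R_def intro: inj_on_subset)
  obtain f :: "nat \<Rightarrow> nat" where f: "\<And>l. l \<in> R \<Longrightarrow> f l < 3"
    "\<And>l l'. l \<in> R \<Longrightarrow> l' \<in> R \<Longrightarrow> l \<noteq> l' \<Longrightarrow> i l = j l' \<Longrightarrow> f l \<noteq> f l'"
    using index_shift_colouring[OF fin(2) inR] by blast
  define L where "L = (\<lambda>c. {l\<in>R. f l = c})"
  \<comment> \<open>Rows \<open>i l\<close> and \<open>j l\<close> of the matrix are put side by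
    side, giving \<open>2 * k\<close> entries to be paired with the vector
    \<open>(y, - y')\<close>.\<close>
  define \<phi> where "\<phi> = (\<lambda>(l, a). if a < k then (i l, a) else (j l, a - k))"
  define \<psi> where "\<psi> = (\<lambda>(l, a::nat). (i l, a))"
  have "inj_on \<psi> (Q \<times> {..<k})" "\<psi> ` (Q \<times> {..<k}) \<subseteq> ?I"
    using i by (auto simp: \<psi>_def Q_def inj_on_def)
  note unifQ = gaussian_quadratic_form_uniform[OF I fin(1) this k x, folded gaussian_entries_def]
  obtain badQ where badQ: "badQ \<in> sets ?P" "prob badQ \<le> 2 * 1024 ^ k * exp (- 8 * x)"
    "\<And>\<omega> (w :: nat \<Rightarrow> real). \<omega> \<in> space ?P - badQ \<Longrightarrow>
      \<bar>(\<Sum>l\<in>Q. (\<Sum>a<k. w a * \<omega> (\<psi> (l, a)))\<^sup>2) - card Q * (\<Sum>a<k. (w a)\<^sup>2)\<bar>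
        \<le> 96 * (sqrt (card Q * x) + x) * (\<Sum>a<k. (w a)\<^sup>2)"
    using unifQ by (elim exE conjE) simp
  define good where "good = (\<lambda>c bad. bad \<in> sets ?P \<and> prob bad \<le> 2 * 1024 ^ (2 * k) * exp (- 8 * x) \<and>
    (\<forall>\<omega> (w :: nat \<Rightarrow> real). \<omega> \<in> space ?P - bad \<longrightarrow>
      \<bar>(\<Sum>l\<in>L c. (\<Sum>a<2*k. w a * \<omega> (\<phi> (l, a)))\<^sup>2) - card (L c) * (\<Sum>a<2*k. (w a)\<^sup>2)\<bar>
        \<le> 96 * (sqrt (card (L c) * x) + x) * (\<Sum>a<2*k. (w a)\<^sup>2)))"
  have "\<exists>bad. good c bad" for c
  proof -
    have inj: "inj_on \<phi> (L c \<times> {..<2*k})"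
    proof (rule inj_onI, clarify)
      fix l a l' a' assume l: "l \<in> L c" "l' \<in> L c" and eq: "\<phi> (l, a) = \<phi> (l', a')"
      have R: "l \<in> R" "l' \<in> R" and fe: "f l = f l'" using l by (auto simp: L_def)
      \<comment> \<open>Coincidences with \<open>l = l'\<close> are excluded by the definition of
        \<open>R\<close>, the others by the colouring; so left and right halves of the array never
        share an entry.\<close>
      have ne: "i l \<noteq> j l'" "i l' \<noteq> j l"
        using f(2)[OF R] f(2)[OF R(2,1)] fe R unfolding R_def by (cases "l = l'"; force)+
      then have "a < k \<longleftrightarrow> a' < k" using eq by (auto simp: \<phi>_def split: if_splits)
      moreover have "a = a'" using calculation eq by (auto simp: \<phi>_def split: if_splits)
      ultimately show "l = l' \<and> a = a'"
        using eq inj_onD[OF inR(1) _ R] inj_onD[OF inR(2) _ R] by (auto simp: \<phi>_def split: if_splits)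
    qed
    have img: "\<phi> ` (L c \<times> {..<2*k}) \<subseteq> ?I"
      using i(2) j(2) by (auto simp: \<phi>_def L_def R_def split: if_splits)
    have "finite (L c)" "0 < 2 * k" using fin k by (auto simp: L_def)
    from gaussian_quadratic_form_uniform[OF I this(1) inj img this(2) x] show ?thesis
      unfolding gaussian_entries_def[symmetric] good_def .
  qed
  then obtain badR where "\<And>c. good c (badR c)" by metis
  then have badR: "\<And>c. badR c \<in> sets ?P" "\<And>c. prob (badR c) \<le> 2 * 1024 ^ (2 * k) * exp (- 8 * x)"
    "\<And>c \<omega> (w :: nat \<Rightarrow> real). \<omega> \<in> space ?P - badR c \<Longrightarrow>
      \<bar>(\<Sum>l\<in>L c. (\<Sum>a<2*k. w a * \<omega> (\<phi> (l, a)))\<^sup>2) - card (L c) * (\<Sum>a<2*k. (w a)\<^sup>2)\<bar>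
        \<le> 96 * (sqrt (card (L c) * x) + x) * (\<Sum>a<2*k. (w a)\<^sup>2)"
    by (simp_all add: good_def)
  \<comment> \<open>Four exceptional sets, one for \<open>Q\<close> and one per colour, which
    accounts for the factor 8 = 4 * 2.\<close>
  define bad where "bad = badQ \<union> (\<Union>c<3. badR c)"
  have "prob bad \<le> prob badQ + prob (\<Union>c<3. badR c)"
    unfolding bad_def by (intro measure_Un_le) (auto intro: badQ badR)
  also have "\<dots> \<le> 2 * 1024 ^ (2 * k) * exp (- 8 * x) + (\<Sum>c<(3::nat). 2 * 1024 ^ (2 * k) * exp (- 8 * x))"
  proof (intro add_mono)
    have "(1024::real) ^ k \<le> 1024 ^ (2 * k)" by (intro power_increasing) auto
    then have "2 * 1024 ^ k * exp (- 8 * x) \<le> 2 * 1024 ^ (2 * k) * exp (- 8 * x)" by (simp add: mult_ac)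
    then show "prob badQ \<le> 2 * 1024 ^ (2 * k) * exp (- 8 * x)" using badQ(2) by linarith
    have "prob (\<Union>c<3. badR c) \<le> (\<Sum>c<3. prob (badR c))"
      by (intro finite_measure_subadditive_finite) (auto intro: badR)
    also have "\<dots> \<le> (\<Sum>c<(3::nat). 2 * 1024 ^ (2 * k) * exp (- 8 * x))" by (intro sum_mono badR)
    finally show "prob (\<Union>c<3. badR c) \<le> (\<Sum>c<(3::nat). 2 * 1024 ^ (2 * k) * exp (- 8 * x))" .
  qed
  finally have pbad: "prob bad \<le> 8 * 1024 ^ (2 * k) * exp (- 8 * x)" by (simp add: mult_ac)
  have "\<bar>(\<Sum>l<m. ((\<Sum>a<k. y a * \<omega> (i l, a)) - (\<Sum>a<k. y' a * \<omega> (j l, a)))\<^sup>2)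
        - (card Q * (\<Sum>a<k. (y a - y' a)\<^sup>2) + card R * ((\<Sum>a<k. (y a)\<^sup>2) + (\<Sum>a<k. (y' a)\<^sup>2)))\<bar>
      \<le> 96 * (sqrt (card Q * x) + x) * (\<Sum>a<k. (y a - y' a)\<^sup>2)
        + 288 * (sqrt (card R * x) + x) * ((\<Sum>a<k. (y a)\<^sup>2) + (\<Sum>a<k. (y' a)\<^sup>2))"
    if \<omega>: "\<omega> \<in> space ?P - bad" for \<omega> and y y' :: "nat \<Rightarrow> real"
  proof -
    define D where "D = (\<Sum>a<k. (y a - y' a)\<^sup>2)"
    define E where "E = (\<Sum>a<k. (y a)\<^sup>2) + (\<Sum>a<k. (y' a)\<^sup>2)"
    have E0: "0 \<le> E" by (simp add: E_def sum_nonneg)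
    define T where "T = (\<lambda>l. ((\<Sum>a<k. y a * \<omega> (i l, a)) - (\<Sum>a<k. y' a * \<omega> (j l, a)))\<^sup>2)"
    define w where "w = (\<lambda>a. if a < k then y a else - y' (a - k))"
    have split2k: "(\<Sum>a<2*k. g a) = (\<Sum>a<k. g a) + (\<Sum>a<k. g (a + k))" for g :: "nat \<Rightarrow> real"
      using sum.nat_group[of g k 2] by (simp add: numeral_2_eq_2 lessThan_Suc_eq_insert_0 sum.shift_bounds_nat_ivl[of g 0 k k, simplified] lessThan_atLeast0 add.commute)
    have "(\<Sum>l\<in>Q. (\<Sum>a<k. (y a - y' a) * \<omega> (\<psi> (l, a)))\<^sup>2) = sum T Q"
      by (intro sum.cong refl) (simp add: T_def Q_def \<psi>_def left_diff_distrib sum_subtractf)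
    then have TQ: "\<bar>sum T Q - card Q * D\<bar> \<le> 96 * (sqrt (card Q * x) + x) * D"
      using badQ(3)[of \<omega> "\<lambda>a. y a - y' a"] \<omega> by (simp add: bad_def D_def)
    have wE: "(\<Sum>a<2*k. (w a)\<^sup>2) = E" by (simp add: split2k w_def E_def)
    \<comment> \<open>Enlarging each class size to \<open>card R\<close> makes the three colour
      bounds equal; their sum explains 288 = 3 * 96.\<close>
    have TR: "\<bar>sum T (L c) - card (L c) * E\<bar> \<le> 96 * (sqrt (card R * x) + x) * E" if "c < 3" for c
    proof -
      have "(\<Sum>l\<in>L c. (\<Sum>a<2*k. w a * \<omega> (\<phi> (l, a)))\<^sup>2) = sum T (L c)"
        by (intro sum.cong refl) (simp add: T_def split2k w_def \<phi>_def sum_negf)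
      then have "\<bar>sum T (L c) - card (L c) * E\<bar> \<le> 96 * (sqrt (card (L c) * x) + x) * E"
        using badR(3)[of \<omega> c w] \<omega> that by (simp add: bad_def wE)
      also have "\<dots> \<le> 96 * (sqrt (card R * x) + x) * E"
      proof (intro mult_right_mono mult_left_mono add_right_mono real_sqrt_le_mono E0)
        have "card (L c) \<le> card R" unfolding L_def using fin by (intro card_mono) auto
        then show "real (card (L c)) \<le> real (card R)" by simp
      qed (use x in auto)
      finally show ?thesis .
    qed
    have part: "R = L 0 \<union> L 1 \<union> L 2" using f(1) by (fastforce simp: L_def)
    have disj: "L 0 \<inter> L 1 = {}" "(L 0 \<union> L 1) \<inter> L 2 = {}" by (auto simp: L_def)
    have finL: "finite (L c)" for c using fin by (simp add: L_def)
    have sR: "sum T R = sum T (L 0) + sum T (L 1) + sum T (L 2)"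
      unfolding part using disj finL by (simp add: sum.union_disjoint)
    have cR: "card R = card (L 0) + card (L 1) + card (L 2)"
      unfolding part using disj finL by (simp add: card_Un_disjoint)
    have "{..<m} = Q \<union> R" "Q \<inter> R = {}" by (auto simp: Q_def R_def)
    then have "sum T {..<m} = sum T Q + sum T R" using fin by (simp add: sum.union_disjoint)
    then have "\<bar>sum T {..<m} - (card Q * D + card R * E)\<bar> \<le>
        96 * (sqrt (card Q * x) + x) * D + 3 * (96 * (sqrt (card R * x) + x) * E)"
      using TQ TR[of 0] TR[of 1] TR[of 2] by (simp add: sR cR distrib_right)
    also have "3 * (96 * (sqrt (card R * x) + x) * E) = 288 * (sqrt (card R * x) + x) * E" by simp
    finally show ?thesis unfolding T_def D_def E_def .
  qed
  moreover have "bad \<in> sets ?P" unfolding bad_def by (auto intro: badQ badR)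
  ultimately show ?thesis using pbad by blast
qed

section \<open>Kronecker products with selection matrices\<close>

text \<open>Column \<open>c = a * n + p\<close> of a Kronecker product belongs to entry
  \<open>a\<close> of the row vector and column \<open>p\<close> of the selection; this turns sums
  over columns into double sums.\<close>

lemma sum_mult_div_mod:
  fixes g :: "nat \<Rightarrow> nat \<Rightarrow> 'a :: comm_monoid_add"
  shows "(\<Sum>c<k * n. g (c div n) (c mod n)) = (\<Sum>a<k. \<Sum>p<n. g a p)"
proof -
  have "(\<Sum>c<k * n. g (c div n) (c mod n)) = (\<Sum>a<k. \<Sum>c=a * n..<a * n + n. g (c div n) (c mod n))"
    by (rule sum.nat_group[symmetric])
  also have "\<dots> = (\<Sum>a<k. \<Sum>p<n. g a p)"
  proof (rule sum.cong[OF refl])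
    fix a
    have "(\<Sum>c=a * n..<a * n + n. g (c div n) (c mod n)) = (\<Sum>p=0..<n. g ((p + a * n) div n) ((p + a * n) mod n))"
      using sum.shift_bounds_nat_ivl[of "\<lambda>c. g (c div n) (c mod n)" 0 "a * n" n] by (simp add: add.commute)
    also have "\<dots> = (\<Sum>p<n. g a p)" by (intro sum.cong) auto
    finally show "(\<Sum>c=a * n..<a * n + n. g (c div n) (c mod n)) = (\<Sum>p<n. g a p)" .
  qed
  finally show ?thesis .
qed

section \<open>Selections as increasing index maps\<close>

definition selection :: "nat \<Rightarrow> nat \<Rightarrow> (nat \<Rightarrow> nat) \<Rightarrow> real mat" where
  "selection m n i = mat m n (\<lambda>(l, p). if p = i l then 1 else 0)"

text \<open>Extensionality fixes the values outside \<open>{..<m}\<close>, so the set is finite and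
  a map is determined by its values below \<open>m\<close>.\<close>

definition index_maps :: "nat \<Rightarrow> nat \<Rightarrow> (nat \<Rightarrow> nat) set" where
  "index_maps m n = {i \<in> {..<m} \<rightarrow>\<^sub>E {..<n}. strict_mono_on {..<m} i}"

lemma selection_matrices_eq: "selection_matrices m n = selection m n ` index_maps m n"
proof (intro equalityI subsetI)
  fix S assume "S \<in> selection_matrices m n"
  then obtain i :: "nat \<Rightarrow> nat" where S: "S \<in> carrier_mat m n" and i: "\<forall>l<m. i l < n" "strict_mono_on {..<m} i"
    "\<forall>l<m. \<forall>p<n. S $$ (l, p) = (if p = i l then 1 else 0)"
    by (auto simp: selection_matrices_def)
  have "S = selection m n (restrict i {..<m})"
    using S i(3) by (intro eq_matI) (auto simp: selection_def)
  moreover have "restrict i {..<m} \<in> index_maps m n"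
    using i(1,2) by (auto simp: index_maps_def strict_mono_on_def)
  ultimately show "S \<in> selection m n ` index_maps m n" by blast
next
  fix S assume "S \<in> selection m n ` index_maps m n"
  then show "S \<in> selection_matrices m n"
    by (fastforce simp: selection_matrices_def index_maps_def selection_def)
qed

lemma finite_index_maps: "finite (index_maps m n)"
proof -
  have "index_maps m n \<subseteq> {..<m} \<rightarrow>\<^sub>E {..<n}" by (auto simp: index_maps_def)
  then show ?thesis by (rule finite_subset) (auto intro: finite_PiE)
qed

lemma inj_on_index_map: "i \<in> index_maps m n \<Longrightarrow> inj_on i {..<m}"
  by (auto simp: index_maps_def intro: strict_mono_on_imp_inj_on)

text \<open>An increasing map is recovered from its range by sorting, and the range is an
  \<open>m\<close>-element subset of \<open>{..<n}\<close>.\<close>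

lemma card_index_maps_le: "card (index_maps m n) \<le> n choose m"
proof -
  have "inj_on (\<lambda>i. i ` {..<m}) (index_maps m n)"
  proof (rule inj_onI)
    fix i j assume ij: "i \<in> index_maps m n" "j \<in> index_maps m n" and eq: "i ` {..<m} = j ` {..<m}"
    have sorted: "sorted (map i [0..<m])" "distinct (map i [0..<m])" if "i \<in> index_maps m n" for i
    proof -
      have "i a < i b" if "a < b" "b < m" for a b
        using \<open>i \<in> index_maps m n\<close> that by (auto simp: index_maps_def strict_mono_on_def)
      then show "sorted (map i [0..<m])"
        by (auto simp: sorted_iff_nth_mono_less intro: less_imp_le)
      show "distinct (map i [0..<m])"
        using inj_on_index_map[OF that] by (simp add: distinct_map atLeast0LessThan)
    qed
    have "map i [0..<m] = map j [0..<m]"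
      using sorted[OF ij(1)] sorted[OF ij(2)] eq
      by (intro sorted_distinct_set_unique) (auto simp: atLeast0LessThan)
    then have "i l = j l" if "l < m" for l using that by (simp add: list_eq_iff_nth_eq)
    moreover have "i l = j l" if "\<not> l < m" for l
      using ij that by (auto simp: index_maps_def PiE_def extensional_def)
    ultimately show "i = j" by blast
  qed
  moreover have "(\<lambda>i. i ` {..<m}) ` index_maps m n \<subseteq> {T. T \<subseteq> {..<n} \<and> card T = m}"
  proof (rule image_subsetI, intro CollectI conjI)
    fix i assume i: "i \<in> index_maps m n"
    then show "i ` {..<m} \<subseteq> {..<n}" by (auto simp: index_maps_def)
    show "card (i ` {..<m}) = m" using card_image[OF inj_on_index_map[OF i]] by simp
  qed
  moreover have "finite {T. T \<subseteq> {..<n} \<and> card T = m}" by (rule finite_subset[of _ "Pow {..<n}"]) auto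
  ultimately have "card (index_maps m n) \<le> card {T. T \<subseteq> {..<n} \<and> card T = m}" by (rule card_inj_on_le)
  also have "\<dots> = n choose m" using n_subsets[of "{..<n}" m] by simp
  finally show ?thesis .
qed

text \<open>The coefficient vector is a function on indices, the form in which the concentration
  bounds quantify over it.\<close>

definition kron_row_selection :: "nat \<Rightarrow> nat \<Rightarrow> nat \<Rightarrow> (nat \<Rightarrow> real) \<Rightarrow> (nat \<Rightarrow> nat) \<Rightarrow> real mat" where
  "kron_row_selection k m n y i = mat m (k * n) (\<lambda>(l, c). y (c div n) * (if c mod n = i l then 1 else 0))"

lemma kronecker_row_selection_eq:
  assumes "y \<in> carrier_vec k"
  shows "kronecker (mat_of_row y) (selection m n i) = kron_row_selection k m n (\<lambda>a. vec_index y a) i"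
\<comment> \<open>The bound \<open>c mod n < n\<close> requires positive \<open>n\<close>; for
  \<open>n = 0\<close> neither side has columns.\<close>
proof (cases "n = 0")
  case False
  show ?thesis
  proof (rule eq_matI)
    fix l c assume "l < dim_row (kron_row_selection k m n (\<lambda>a. vec_index y a) i)" "c < dim_col (kron_row_selection k m n (\<lambda>a. vec_index y a) i)"
    then have lc: "l < m" "c < k * n" by (simp_all add: kron_row_selection_def)
    have "c div n < k" using lc(2) by (simp add: less_mult_imp_div_less)
    moreover have "c mod n < n" using False by simp
    ultimately show "kronecker (mat_of_row y) (selection m n i) $$ (l, c) = kron_row_selection k m n (\<lambda>a. vec_index y a) i $$ (l, c)"
      using assms lc by (simp add: kronecker_def kron_row_selection_def selection_def mat_of_row_def)
  qed (use assms in \<open>simp_all add: kronecker_def kron_row_selection_def selection_def\<close>)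
qed (use assms in \<open>auto intro!: eq_matI simp: kronecker_def kron_row_selection_def selection_def\<close>)

lemma H_set_eq: "H_set k m n = {kron_row_selection k m n y i | y i. i \<in> index_maps m n}"
proof (intro equalityI subsetI)
  fix H assume "H \<in> H_set k m n"
  show "H \<in> {kron_row_selection k m n y i | y i. i \<in> index_maps m n}"
  proof -
    obtain y i where "y \<in> carrier_vec k" "i \<in> index_maps m n" "H = kronecker (mat_of_row y) (selection m n i)"
      using \<open>H \<in> H_set k m n\<close> unfolding H_set_def selection_matrices_eq by blast
    then show ?thesis using kronecker_row_selection_eq by blast
  qed
next
  fix H assume "H \<in> {kron_row_selection k m n y i | y i. i \<in> index_maps m n}"
  then obtain y i where H: "H = kron_row_selection k m n y i" and i: "i \<in> index_maps m n" by blast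
  have "H = kron_row_selection k m n (\<lambda>a. vec_index (vec k y) a) i"
    unfolding H kron_row_selection_def by (intro eq_matI) (auto simp: less_mult_imp_div_less)
  also have "\<dots> = kronecker (mat_of_row (vec k y)) (selection m n i)"
    by (subst kronecker_row_selection_eq) auto
  finally show "H \<in> H_set k m n"
    unfolding H_set_def selection_matrices_eq using i vec_carrier by blast
qed

section \<open>Frobenius norms of differences and their action on the stacked matrix\<close>

lemma frob_norm_sq: "(frob_norm A)\<^sup>2 = (\<Sum>r<dim_row A. \<Sum>c<dim_col A. (A $$ (r, c))\<^sup>2)"
  unfolding frob_norm_def L2_set_def by (simp add: sum_nonneg sum.cartesian_product)

lemma frob_norm_nonneg: "0 \<le> frob_norm A"
  by (simp add: frob_norm_def)

lemma frob_norm_kron_row_selection_sq: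
  fixes y :: "nat \<Rightarrow> real"
  assumes "\<And>l. l < m \<Longrightarrow> i l < n"
  shows "(frob_norm (kron_row_selection k m n y i))\<^sup>2 = m * (\<Sum>a<k. (y a)\<^sup>2)"
proof -
  have "(frob_norm (kron_row_selection k m n y i))\<^sup>2 =
      (\<Sum>l<m. \<Sum>c<k * n. (\<lambda>a p. (y a * (if p = i l then 1 else 0))\<^sup>2) (c div n) (c mod n))"
    by (simp add: frob_norm_sq kron_row_selection_def)
  also have "\<dots> = (\<Sum>l<m. \<Sum>a<k. \<Sum>p<n. (y a * (if p = i l then 1 else 0))\<^sup>2)"
    by (rule sum.cong[OF refl], rule sum_mult_div_mod)
  also have "\<dots> = (\<Sum>l<m. \<Sum>a<k. (y a)\<^sup>2)"
  proof (intro sum.cong refl)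
    fix l a assume "l \<in> {..<m}"
    have "(\<Sum>p<n. (y a * (if p = i l then 1 else 0))\<^sup>2) = (\<Sum>p<n. if p = i l then (y a)\<^sup>2 else 0)"
      by (intro sum.cong) auto
    then show "(\<Sum>p<n. (y a * (if p = i l then 1 else 0))\<^sup>2) = (y a)\<^sup>2"
      using assms \<open>l \<in> {..<m}\<close> by simp
  qed
  finally show ?thesis by simp
qed

text \<open>Where \<open>i l = j l\<close> the two rows have the same support and subtract
  entrywise; otherwise their supports are disjoint and the squared norms add.\<close>

lemma frob_norm_kron_row_selection_diff_sq:
  fixes y y' :: "nat \<Rightarrow> real"
  assumes "\<And>l. l < m \<Longrightarrow> i l < n" "\<And>l. l < m \<Longrightarrow> j l < n"
  shows "(frob_norm (kron_row_selection k m n y i - kron_row_selection k m n y' j))\<^sup>2 =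
    card {l\<in>{..<m}. i l = j l} * (\<Sum>a<k. (y a - y' a)\<^sup>2)
    + card {l\<in>{..<m}. i l \<noteq> j l} * ((\<Sum>a<k. (y a)\<^sup>2) + (\<Sum>a<k. (y' a)\<^sup>2))"
proof -
  have row: "(\<Sum>a<k. \<Sum>p<n. (y a * (if p = i l then 1 else 0) - y' a * (if p = j l then 1 else 0))\<^sup>2) =
      (if i l = j l then (\<Sum>a<k. (y a - y' a)\<^sup>2) else (\<Sum>a<k. (y a)\<^sup>2) + (\<Sum>a<k. (y' a)\<^sup>2))"
    if "l < m" for l
  proof -
    have "(\<Sum>p<n. (y a * (if p = i l then 1 else 0) - y' a * (if p = j l then 1 else 0))\<^sup>2) =
        (if i l = j l then (y a - y' a)\<^sup>2 else (y a)\<^sup>2 + (y' a)\<^sup>2)" for a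
    proof -
      have "(\<Sum>p<n. (y a * (if p = i l then 1 else 0) - y' a * (if p = j l then 1 else 0))\<^sup>2) =
         (\<Sum>p<n. (if p = i l then (if i l = j l then (y a - y' a)\<^sup>2 else (y a)\<^sup>2) else 0)
           + (if p = j l then (if i l = j l then 0 else (y' a)\<^sup>2) else 0))"
      proof (intro sum.cong refl)
        fix p
        show "(y a * (if p = i l then 1 else 0) - y' a * (if p = j l then 1 else 0))\<^sup>2 =
          (if p = i l then (if i l = j l then (y a - y' a)\<^sup>2 else (y a)\<^sup>2) else 0)
           + (if p = j l then (if i l = j l then 0 else (y' a)\<^sup>2) else 0)"
          by (cases "i l = j l"; cases "p = i l"; cases "p = j l") simp_all
      qed
      also have "\<dots> = (if i l = j l then (y a - y' a)\<^sup>2 else (y a)\<^sup>2 + (y' a)\<^sup>2)"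
        using assms that by (cases "i l = j l") (simp_all add: sum.distrib)
      finally show ?thesis .
    qed
    then show ?thesis by (simp add: sum.distrib)
  qed
  have "(frob_norm (kron_row_selection k m n y i - kron_row_selection k m n y' j))\<^sup>2 =
      (\<Sum>l<m. \<Sum>c<k * n. (\<lambda>a p. (y a * (if p = i l then 1 else 0) - y' a * (if p = j l then 1 else 0))\<^sup>2) (c div n) (c mod n))"
    by (simp add: frob_norm_sq kron_row_selection_def)
  also have "\<dots> = (\<Sum>l<m. if i l = j l then (\<Sum>a<k. (y a - y' a)\<^sup>2) else (\<Sum>a<k. (y a)\<^sup>2) + (\<Sum>a<k. (y' a)\<^sup>2))"
  proof (rule sum.cong[OF refl])
    fix l assume "l \<in> {..<m}"
    then show "(\<Sum>c<k * n. (\<lambda>a p. (y a * (if p = i l then 1 else 0) - y' a * (if p = j l then 1 else 0))\<^sup>2) (c div n) (c mod n)) =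
        (if i l = j l then (\<Sum>a<k. (y a - y' a)\<^sup>2) else (\<Sum>a<k. (y a)\<^sup>2) + (\<Sum>a<k. (y' a)\<^sup>2))"
      using row unfolding sum_mult_div_mod[where g = "\<lambda>a p. (y a * (if p = i l then 1 else 0) - y' a * (if p = j l then 1 else 0))\<^sup>2"] by simp
  qed
  also have "\<dots> = card {l\<in>{..<m}. i l = j l} * (\<Sum>a<k. (y a - y' a)\<^sup>2)
    + card {l\<in>{..<m}. i l \<noteq> j l} * ((\<Sum>a<k. (y a)\<^sup>2) + (\<Sum>a<k. (y' a)\<^sup>2))"
    by (subst sum.If_cases) (auto simp: Int_def Compl_eq)
  finally show ?thesis .
qed

text \<open>This is the identity of \<open>(H - H') vec B\<close> with
  \<open>S B y - S' B y'\<close>, read row by row: column \<open>a * n + p\<close> meets entry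
  \<open>(p, a)\<close> of the matrix.\<close>

lemma vnorm_kron_row_selection_diff_mult_sq:
  fixes y y' :: "nat \<Rightarrow> real"
  assumes "\<And>l. l < m \<Longrightarrow> i l < n" "\<And>l. l < m \<Longrightarrow> j l < n"
  shows "(vnorm ((kron_row_selection k m n y i - kron_row_selection k m n y' j) *\<^sub>v vec_of_mat (mat n k \<omega>)))\<^sup>2 =
    (\<Sum>l<m. ((\<Sum>a<k. y a * \<omega> (i l, a)) - (\<Sum>a<k. y' a * \<omega> (j l, a)))\<^sup>2)"
proof -
  have entry: "vec_index ((kron_row_selection k m n y i - kron_row_selection k m n y' j) *\<^sub>v vec_of_mat (mat n k \<omega>)) l =
      (\<Sum>a<k. y a * \<omega> (i l, a)) - (\<Sum>a<k. y' a * \<omega> (j l, a))" if l: "l < m" for l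
  proof -
    have "vec_index ((kron_row_selection k m n y i - kron_row_selection k m n y' j) *\<^sub>v vec_of_mat (mat n k \<omega>)) l =
       (\<Sum>c<k * n. (\<lambda>a p. (y a * (if p = i l then 1 else 0) - y' a * (if p = j l then 1 else 0)) * \<omega> (p, a)) (c div n) (c mod n))"
    proof -
      have n: "0 < n" using assms(1)[OF l] by simp
      have "vec_index ((kron_row_selection k m n y i - kron_row_selection k m n y' j) *\<^sub>v vec_of_mat (mat n k \<omega>)) l =
         (\<Sum>c\<in>{0..<n * k}. (kron_row_selection k m n y i - kron_row_selection k m n y' j) $$ (l, c) * \<omega> (c mod n, c div n))"
        using l n by (simp add: kron_row_selection_def vec_of_mat_def scalar_prod_def less_mult_imp_div_less mult.commute)
      also have "\<dots> = (\<Sum>c<k * n. (\<lambda>a p. (y a * (if p = i l then 1 else 0) - y' a * (if p = j l then 1 else 0)) * \<omega> (p, a)) (c div n) (c mod n))"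
        using l by (intro sum.cong) (auto simp: kron_row_selection_def mult.commute)
      finally show ?thesis .
    qed
    also have "\<dots> = (\<Sum>a<k. \<Sum>p<n. (y a * (if p = i l then 1 else 0) - y' a * (if p = j l then 1 else 0)) * \<omega> (p, a))"
      by (rule sum_mult_div_mod)
    also have "\<dots> = (\<Sum>a<k. y a * \<omega> (i l, a) - y' a * \<omega> (j l, a))"
    proof (intro sum.cong refl)
      fix a
      have "(\<Sum>p<n. (y a * (if p = i l then 1 else 0) - y' a * (if p = j l then 1 else 0)) * \<omega> (p, a)) =
         (\<Sum>p<n. (if p = i l then y a * \<omega> (p, a) else 0) - (if p = j l then y' a * \<omega> (p, a) else 0))"
        by (intro sum.cong) (auto simp: left_diff_distrib)
      then show "(\<Sum>p<n. (y a * (if p = i l then 1 else 0) - y' a * (if p = j l then 1 else 0)) * \<omega> (p, a)) =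
          y a * \<omega> (i l, a) - y' a * \<omega> (j l, a)"
        using assms l by (simp add: sum_subtractf)
    qed
    finally show ?thesis by (simp add: sum_subtractf)
  qed
  have dim: "dim_vec ((kron_row_selection k m n y i - kron_row_selection k m n y' j) *\<^sub>v vec_of_mat (mat n k \<omega>)) = m"
    by (simp add: kron_row_selection_def)
  show ?thesis
    unfolding vnorm_def L2_set_def dim using entry by (simp add: sum_nonneg)
qed

section \<open>The relaxed restricted isometry property\<close>

text \<open>The property is an uncountable intersection over pairs \<open>H\<close>,
  \<open>H'\<close>, but each condition is a closed one on a polynomial in the entries, so the
  intersection is closed and hence Borel.\<close>

lemma sets_R_RIP:
  "{\<omega> \<in> space (gaussian_entries n k). R_RIP (H_set k m n) \<delta> \<mu> (mat n k \<omega>)} \<in> sets (gaussian_entries n k)"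
proof -
  let ?I = "{..<n} \<times> {..<k}"
  define V where "V = (\<lambda>H H' (\<omega> :: nat \<times> nat \<Rightarrow> real). (vnorm ((H - H') *\<^sub>v vec_of_mat (mat n k \<omega>)))\<^sup>2)"
  define J where "J = {(H, H'). H \<in> H_set k m n \<and> H' \<in> H_set k m n \<and>
    frob_norm (H - H') \<ge> \<mu> * max (frob_norm H) (frob_norm H')}"
  define C where "C = {\<omega>. R_RIP (H_set k m n) \<delta> \<mu> (mat n k \<omega>)}"
  have C: "C = (\<Inter>(H, H')\<in>J. {\<omega>. (1 - \<delta>) * (frob_norm (H - H'))\<^sup>2 \<le> V H H' \<omega>} \<inter> {\<omega>. V H H' \<omega> \<le> (1 + \<delta>) * (frob_norm (H - H'))\<^sup>2})"
    unfolding C_def J_def V_def R_RIP_def by auto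
  have cont: "continuous_on UNIV (V H H')" if "(H, H') \<in> J" for H H'
  proof -
    have "H \<in> H_set k m n" "H' \<in> H_set k m n" using that by (simp_all add: J_def)
    then obtain y i y' j where H: "H = kron_row_selection k m n y i" "H' = kron_row_selection k m n y' j"
      and ij: "i \<in> index_maps m n" "j \<in> index_maps m n"
      unfolding H_set_eq by blast
    have "\<And>l. l < m \<Longrightarrow> i l < n" "\<And>l. l < m \<Longrightarrow> j l < n"
      using ij by (auto simp: index_maps_def)
    then have "V H H' = (\<lambda>\<omega>. \<Sum>l<m. ((\<Sum>a<k. y a * \<omega> (i l, a)) - (\<Sum>a<k. y' a * \<omega> (j l, a)))\<^sup>2)"
      unfolding V_def H by (intro ext vnorm_kron_row_selection_diff_mult_sq)
    then show ?thesis
      by (simp only:) (intro continuous_intros continuous_on_product_coordinates)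
  qed
  have "closed C"
    unfolding C using cont by (intro closed_INT) (auto intro!: closed_Int closed_Collect_le continuous_on_const)
  then have "C \<in> sets (\<Pi>\<^sub>M p\<in>(UNIV :: (nat \<times> nat) set). (borel :: real measure))"
    unfolding sets_PiM_equal_borel by (rule borel_closed)
  \<comment> \<open>Samples live on the finite index set, the topology on functions on all index
    pairs. Extension by 0 is measurable and leaves \<open>mat n k \<omega>\<close>
    unchanged.\<close>
  moreover define ext where "ext = (\<lambda>(\<omega> :: nat \<times> nat \<Rightarrow> real) p. if p \<in> ?I then \<omega> p else 0)"
  have "ext \<in> measurable (gaussian_entries n k) (\<Pi>\<^sub>M p\<in>(UNIV :: (nat \<times> nat) set). (borel :: real measure))"
  proof (rule measurable_PiM_single')
    fix p :: "nat \<times> nat"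
    show "(\<lambda>\<omega>. ext \<omega> p) \<in> borel_measurable (gaussian_entries n k)"
      unfolding ext_def gaussian_entries_def
      by (cases "p \<in> ?I") (simp_all only: if_True if_False measurable_PiM_std_normal_component borel_measurable_const)
  qed (auto simp: ext_def)
  ultimately have "ext -` C \<inter> space (gaussian_entries n k) \<in> sets (gaussian_entries n k)"
    by (intro measurable_sets)
  moreover have "mat n k (ext \<omega>) = mat n k \<omega>" for \<omega>
    by (intro eq_matI) (auto simp: ext_def)
  then have "ext -` C \<inter> space (gaussian_entries n k) =
      {\<omega> \<in> space (gaussian_entries n k). R_RIP (H_set k m n) \<delta> \<mu> (mat n k \<omega>)}"
    by (auto simp: C_def)
  ultimately show ?thesis by simp
qed

text \<open>With \<open>s = \<delta> / 2000\<close> one has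
  \<open>x = s ^ 2 * m * \<mu> ^ 2\<close>, so the precision condition makes \<open>x * E\<close>
  and \<open>x * D\<close> multiples of \<open>s ^ 2 * f\<close>. Each square-root term is a
  geometric mean, such as that of \<open>q * D \<le> f\<close> and \<open>x * D\<close>, hence a
  multiple of \<open>s * f\<close>.\<close>

lemma deviation_bound:
  fixes q p D E f m \<mu> \<delta> x :: real
  assumes f: "f = q * D + p * E" and nonneg: "0 \<le> q" "0 \<le> p" "0 \<le> D" "0 \<le> E" "0 \<le> m"
    and D: "D \<le> 2 * E" and E: "m * \<mu>\<^sup>2 * E \<le> 2 * f" and \<delta>: "0 < \<delta>" "\<delta> < 1"
    and x: "x = m * \<delta>\<^sup>2 * \<mu>\<^sup>2 / 4000000"
  shows "96 * (sqrt (q * x) + x) * D + 288 * (sqrt (p * x) + x) * E \<le> \<delta> * f"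
proof -
  define s where "s = \<delta> / 2000"
  have s: "0 < s" "s < 1" using \<delta> by (auto simp: s_def)
  have xs: "x = s\<^sup>2 * (m * \<mu>\<^sup>2)" by (simp add: x s_def power_divide)
  have x0: "0 \<le> x" using nonneg by (simp add: xs)
  have f0: "0 \<le> f" using nonneg by (simp add: f)
  have qD: "q * D \<le> f" "0 \<le> q * D" and pE: "p * E \<le> f" "0 \<le> p * E" using nonneg by (simp_all add: f)
  have xE: "x * E \<le> 2 * (s\<^sup>2 * f)"
  proof -
    have "x * E = s\<^sup>2 * (m * \<mu>\<^sup>2 * E)" by (simp add: xs)
    also have "\<dots> \<le> s\<^sup>2 * (2 * f)" using E by (intro mult_left_mono) auto
    finally show ?thesis by simp
  qed
  have xD: "x * D \<le> 4 * (s\<^sup>2 * f)"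
    using mult_left_mono[OF D x0] xE by linarith
  have ss: "s\<^sup>2 * f \<le> s * f"
    using s f0 by (intro mult_right_mono) (auto simp: power2_eq_square mult_left_le)
  have 1: "sqrt (q * x) * D \<le> 2 * (s * f)"
  proof (rule power2_le_imp_le)
    have "(sqrt (q * x) * D)\<^sup>2 = (q * D) * (x * D)"
      using nonneg x0 by (simp add: power_mult_distrib power2_eq_square)
    also have "\<dots> \<le> f * (4 * (s\<^sup>2 * f))"
      using mult_nonneg_nonneg[OF x0 nonneg(3)] by (intro mult_mono qD xD f0)
    also have "\<dots> = (2 * (s * f))\<^sup>2" by (simp add: power2_eq_square)
    finally show "(sqrt (q * x) * D)\<^sup>2 \<le> (2 * (s * f))\<^sup>2" .
  qed (use s f0 in simp)
  have 2: "sqrt (p * x) * E \<le> 2 * (s * f)"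
  proof (rule power2_le_imp_le)
    have "(sqrt (p * x) * E)\<^sup>2 = (p * E) * (x * E)"
      using nonneg x0 by (simp add: power_mult_distrib power2_eq_square)
    also have "\<dots> \<le> f * (2 * (s\<^sup>2 * f))"
      using mult_nonneg_nonneg[OF x0 nonneg(4)] by (intro mult_mono pE xE f0)
    also have "\<dots> \<le> (2 * (s * f))\<^sup>2" using s f0 by (simp add: power2_eq_square)
    finally show "(sqrt (p * x) * E)\<^sup>2 \<le> (2 * (s * f))\<^sup>2" .
  qed (use s f0 in simp)
  have "96 * (sqrt (q * x) + x) * D + 288 * (sqrt (p * x) + x) * E =
      96 * (sqrt (q * x) * D) + 96 * (x * D) + 288 * (sqrt (p * x) * E) + 288 * (x * E)"
    by (simp add: algebra_simps)
  \<comment> \<open>96 * 2 + 96 * 4 + 288 * 2 + 288 * 2 = 1728, which stays below the 2000 in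
    \<open>s\<close>; this fixes the constant 1/4000000 = 1/2000^2.\<close>
  also have "\<dots> \<le> 1728 * (s * f)" using 1 2 xE xD ss by linarith
  also have "\<dots> \<le> \<delta> * f" using \<delta> f0 by (simp add: s_def)
  finally show ?thesis .
qed

theorem proposition2:
  shows "\<exists>c::real. c > 0 \<and>
    (\<forall>(k::nat) (m::nat) (n::nat) (\<delta>::real) (\<mu>::real).
       0 < k \<longrightarrow> 0 < m \<longrightarrow> 0 < n \<longrightarrow> m \<le> n \<longrightarrow> 0 < \<delta> \<longrightarrow> \<delta> < 1 \<longrightarrow> 0 < \<mu> \<longrightarrow>
       measure (gaussian_entries n k)
         {\<omega> \<in> space (gaussian_entries n k). R_RIP (H_set k m n) \<delta> \<mu> (mat n k \<omega>)}
       > 1 - 2 * (1 + 2 / \<delta>) ^ (2 * k) * (real (n choose m))\<^sup>2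
             * exp (- c * real m * \<delta>\<^sup>2 * \<mu>\<^sup>2))"
proof (intro exI[of _ "1/4000000"] conjI allI impI)
  fix k m n :: nat and \<delta> \<mu> :: real
  assume k: "0 < k" and "0 < m" and n: "0 < n" and mn: "m \<le> n" and \<delta>: "0 < \<delta>" "\<delta> < 1" and \<mu>: "0 < \<mu>"
  let ?P = "gaussian_entries n k"
  let ?A = "{\<omega> \<in> space ?P. R_RIP (H_set k m n) \<delta> \<mu> (mat n k \<omega>)}"
  interpret prob_space ?P unfolding gaussian_entries_def by (rule prob_space_PiM_std_normal)
  define x where "x = real m * \<delta>\<^sup>2 * \<mu>\<^sup>2 / 4000000"
  define b where "b = real (n choose m)"
  define g where "g = (1 + 2 / \<delta>) ^ (2 * k)"
  define e where "e = exp (- x)"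
  have x0: "0 \<le> x" by (simp add: x_def)
  have e0: "0 < e" by (simp add: e_def)
  have b1: "1 \<le> b" using mn by (simp add: b_def Suc_le_eq)
  have g9: "9 ^ k \<le> g"
  proof -
    have "3 \<le> 1 + 2 / \<delta>" using \<delta> by (simp add: field_simps)
    then have "3 ^ (2 * k) \<le> g" unfolding g_def by (intro power_mono) auto
    then show ?thesis by (simp add: power_mult)
  qed
  have "prob ?A > 1 - 2 * g * b\<^sup>2 * e"
  proof (cases "2 * g * b\<^sup>2 * e \<le> 1")
    case False
    then show ?thesis using measure_nonneg[of ?P ?A] by linarith
  next
    case True
    define dev where "dev = (\<lambda>(i :: nat \<Rightarrow> nat) (j :: nat \<Rightarrow> nat) \<omega> (y :: nat \<Rightarrow> real) (y' :: nat \<Rightarrow> real).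
      \<bar>(\<Sum>l<m. ((\<Sum>a<k. y a * \<omega> (i l, a)) - (\<Sum>a<k. y' a * \<omega> (j l, a)))\<^sup>2)
        - (card {l\<in>{..<m}. i l = j l} * (\<Sum>a<k. (y a - y' a)\<^sup>2)
          + card {l\<in>{..<m}. i l \<noteq> j l} * ((\<Sum>a<k. (y a)\<^sup>2) + (\<Sum>a<k. (y' a)\<^sup>2)))\<bar>
      \<le> 96 * (sqrt (card {l\<in>{..<m}. i l = j l} * x) + x) * (\<Sum>a<k. (y a - y' a)\<^sup>2)
        + 288 * (sqrt (card {l\<in>{..<m}. i l \<noteq> j l} * x) + x) * ((\<Sum>a<k. (y a)\<^sup>2) + (\<Sum>a<k. (y' a)\<^sup>2)))"
    define exc where "exc = (\<lambda>i j bad. bad \<in> sets ?P \<and> prob bad \<le> 8 * 1024 ^ (2 * k) * exp (- 8 * x) \<and>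
      (\<forall>\<omega>\<in>space ?P - bad. \<forall>y y'. dev i j \<omega> y y'))"
    have range: "i l < n" if "i \<in> index_maps m n" "l < m" for i l
      using that by (auto simp: index_maps_def)
    have "\<exists>bad. exc i j bad" if "i \<in> index_maps m n" "j \<in> index_maps m n" for i j
      using selection_pair_concentration[OF k inj_on_index_map[OF that(1)] range[OF that(1)]
          inj_on_index_map[OF that(2)] range[OF that(2)] n x0]
      unfolding exc_def dev_def Bex_def .
    then obtain bad where bad: "\<And>i j. i \<in> index_maps m n \<Longrightarrow> j \<in> index_maps m n \<Longrightarrow> exc i j (bad i j)"
      by metis
    \<comment> \<open>Each \<open>bad i j\<close> serves all \<open>y\<close> and \<open>y'\<close>
      at once, so the union runs over finitely many pairs of index maps.\<close>
    define BAD where "BAD = (\<Union>(i, j)\<in>index_maps m n \<times> index_maps m n. bad i j)"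
    have fin: "finite (index_maps m n \<times> index_maps m n)" using finite_index_maps by simp
    have BAD: "BAD \<in> sets ?P"
      unfolding BAD_def using fin bad by (intro sets.finite_UN) (auto simp: exc_def)
    have "prob BAD \<le> (\<Sum>(i, j)\<in>index_maps m n \<times> index_maps m n. prob (bad i j))"
      unfolding BAD_def split_def using fin bad
      by (intro finite_measure_subadditive_finite) (auto simp: exc_def)
    also have "\<dots> \<le> (\<Sum>(i, j)\<in>index_maps m n \<times> index_maps m n. 8 * 1024 ^ (2 * k) * exp (- 8 * x))"
      using bad by (intro sum_mono) (auto simp: exc_def)
    also have "\<dots> = (real (card (index_maps m n)))\<^sup>2 * (8 * 1024 ^ (2 * k) * exp (- 8 * x))"
      by (simp add: split_def card_cartesian_product power2_eq_square)
    also have "\<dots> \<le> b\<^sup>2 * (8 * 1024 ^ (2 * k) * exp (- 8 * x))"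
      using card_index_maps_le[of m n] by (intro mult_right_mono power_mono) (auto simp: b_def)
    also have "\<dots> < b\<^sup>2 * (2 * g * e)"
    proof (intro mult_strict_left_mono)
      \<comment> \<open>Seven of the eight factors \<open>e\<close> pay for the net:
        \<open>9 ^ 7 = 4782969\<close> exceeds \<open>1024 ^ 2 = 1048576\<close>, while
        \<open>9 ^ 6\<close> would not. The eighth factor remains for the claimed bound.\<close>
      have "2 * 9 ^ k * e \<le> 2 * g * b\<^sup>2 * e"
      proof -
        have "2 * 9 ^ k * 1 \<le> 2 * g * b\<^sup>2"
          using g9 b1 by (intro mult_mono) (auto intro: order_trans[OF _ g9])
        then show ?thesis using e0 by (intro mult_right_mono) auto
      qed
      then have "2 * 9 ^ k * e \<le> 1" using True by linarith
      then have "(2 * 9 ^ k * e) ^ 7 \<le> 1" using e0 by (intro power_le_one) auto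
      then have e7: "128 * 4782969 ^ k * e ^ 7 \<le> 1"
        by (simp add: power_mult_distrib power_mult[symmetric] mult.commute[of k])
          (simp add: power_mult)
      have "8 * 1024 ^ (2 * k) * exp (- 8 * x) = 8 * 1048576 ^ k * e ^ 7 * e"
      proof -
        have "exp (- 8 * x) = e ^ 8"
          unfolding e_def exp_of_nat_mult[symmetric] by simp
        also have "\<dots> = e ^ 7 * e" by (simp add: power_Suc2[symmetric] del: power_Suc)
        finally show ?thesis by (simp add: power_mult)
      qed
      also have "\<dots> \<le> 8 * 4782969 ^ k * e ^ 7 * e"
        using e0 by (intro mult_right_mono mult_left_mono power_mono) auto
      also have "\<dots> < 2 * g * e"
      proof (intro mult_strict_right_mono e0)
        have "1 \<le> g" using g9 one_le_power[of "9::real" k] by linarith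
        then show "8 * 4782969 ^ k * e ^ 7 < 2 * g" using e7 by linarith
      qed
      finally show "8 * 1024 ^ (2 * k) * exp (- 8 * x) < 2 * g * e" .
    qed (use b1 in simp)
    finally have PBAD: "prob BAD < 2 * g * b\<^sup>2 * e" by (simp add: mult_ac)
    have "space ?P - BAD \<subseteq> ?A"
    proof
      fix \<omega> assume \<omega>: "\<omega> \<in> space ?P - BAD"
      have "R_RIP (H_set k m n) \<delta> \<mu> (mat n k \<omega>)"
        unfolding R_RIP_def
      proof (intro ballI impI)
        fix H H' assume "H \<in> H_set k m n" "H' \<in> H_set k m n"
          and prec: "\<mu> * max (frob_norm H) (frob_norm H') \<le> frob_norm (H - H')"
        then obtain y i y' j where H: "H = kron_row_selection k m n y i" "H' = kron_row_selection k m n y' j"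
          and ij: "i \<in> index_maps m n" "j \<in> index_maps m n"
          unfolding H_set_eq by blast
        define D where "D = (\<Sum>a<k. (y a - y' a)\<^sup>2)"
        define E where "E = (\<Sum>a<k. (y a)\<^sup>2) + (\<Sum>a<k. (y' a)\<^sup>2)"
        define q where "q = real (card {l\<in>{..<m}. i l = j l})"
        define p where "p = real (card {l\<in>{..<m}. i l \<noteq> j l})"
        define f where "f = (frob_norm (H - H'))\<^sup>2"
        have f: "f = q * D + p * E"
          unfolding f_def H q_def p_def D_def E_def
          using range[OF ij(1)] range[OF ij(2)] by (rule frob_norm_kron_row_selection_diff_sq)
        \<comment> \<open>The precision condition is used for \<open>H\<close> and for
          \<open>H'\<close>; adding the two inequalities bounds \<open>m * \<mu> ^ 2 * E\<close> by
          \<open>2 * f\<close>.\<close>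
        have prec2: "\<mu>\<^sup>2 * (frob_norm G)\<^sup>2 \<le> f" if "G = H \<or> G = H'" for G
        proof -
          have "\<mu> * frob_norm G \<le> \<mu> * max (frob_norm H) (frob_norm H')"
            using that \<mu> by (intro mult_left_mono) auto
          then have "\<mu> * frob_norm G \<le> frob_norm (H - H')" using prec by linarith
          then have "(\<mu> * frob_norm G)\<^sup>2 \<le> f"
            unfolding f_def using \<mu> frob_norm_nonneg by (intro power_mono) auto
          then show ?thesis by (simp add: power_mult_distrib)
        qed
        have "(frob_norm H)\<^sup>2 = m * (\<Sum>a<k. (y a)\<^sup>2)" "(frob_norm H')\<^sup>2 = m * (\<Sum>a<k. (y' a)\<^sup>2)"
          unfolding H by (intro frob_norm_kron_row_selection_sq range ij; assumption)+
        then have "m * \<mu>\<^sup>2 * E = \<mu>\<^sup>2 * (frob_norm H)\<^sup>2 + \<mu>\<^sup>2 * (frob_norm H')\<^sup>2"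
          by (simp add: E_def algebra_simps)
        then have mE: "m * \<mu>\<^sup>2 * E \<le> 2 * f" using prec2[of H] prec2[of H'] by simp
        have DE: "D \<le> 2 * E"
        proof -
          have "D \<le> (\<Sum>a<k. 2 * ((y a)\<^sup>2 + (y' a)\<^sup>2))"
            unfolding D_def
            by (intro sum_mono) (smt (verit) power2_diff power2_sum zero_le_power2)
          then show ?thesis by (simp add: E_def sum.distrib sum_distrib_left)
        qed
        have "\<omega> \<in> space ?P - bad i j" using \<omega> ij by (auto simp: BAD_def)
        then have "dev i j \<omega> y y'" using bad[OF ij] by (auto simp: exc_def)
        moreover have "(vnorm ((H - H') *\<^sub>v vec_of_mat (mat n k \<omega>)))\<^sup>2 =
            (\<Sum>l<m. ((\<Sum>a<k. y a * \<omega> (i l, a)) - (\<Sum>a<k. y' a * \<omega> (j l, a)))\<^sup>2)"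
          unfolding H using range[OF ij(1)] range[OF ij(2)] by (rule vnorm_kron_row_selection_diff_mult_sq)
        ultimately have "\<bar>(vnorm ((H - H') *\<^sub>v vec_of_mat (mat n k \<omega>)))\<^sup>2 - f\<bar>
            \<le> 96 * (sqrt (q * x) + x) * D + 288 * (sqrt (p * x) + x) * E"
          unfolding dev_def f D_def E_def q_def p_def by (simp only:)
        also have "\<dots> \<le> \<delta> * f"
          by (rule deviation_bound[OF f _ _ _ _ _ DE mE \<delta> x_def]) (auto simp: q_def p_def D_def E_def sum_nonneg)
        finally show "(1 - \<delta>) * (frob_norm (H - H'))\<^sup>2 \<le> (vnorm ((H - H') *\<^sub>v vec_of_mat (mat n k \<omega>)))\<^sup>2 \<and>
          (vnorm ((H - H') *\<^sub>v vec_of_mat (mat n k \<omega>)))\<^sup>2 \<le> (1 + \<delta>) * (frob_norm (H - H'))\<^sup>2"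
          unfolding f_def[symmetric] by (simp add: abs_le_iff algebra_simps)
      qed
      then show "\<omega> \<in> ?A" using \<omega> by simp
    qed
    then have "prob (space ?P - BAD) \<le> prob ?A"
      by (intro finite_measure_mono sets_R_RIP)
    then show ?thesis using prob_compl[OF BAD] PBAD by linarith
  qed
  then show "1 - 2 * (1 + 2 / \<delta>) ^ (2 * k) * (real (n choose m))\<^sup>2 * exp (- (1/4000000) * real m * \<delta>\<^sup>2 * \<mu>\<^sup>2) < measure ?P ?A"
    by (simp add: g_def b_def e_def x_def)
qed simp

end
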